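(* Let $(\Lambda,\eta)$ be an isothermic surface in $S^3$ and $z$ a holomorphic coordinate on $\Sigma$ with $\eta=-\psi\wedge(\psi_{\bar z}\,\mathrm{d}z+\psi_z\,\mathrm{d}\bar z)$. Let $c$ be the Schwarzian derivative and $\kappa=kN$ the Hopf differential of $\Lambda$ with respect to $z$, where $N$ is a unit section of $V^\perp$ and $k$ is a real function. Then $(\Lambda,\eta)$ is special isothermic of type $2$ if and only if there are constants $s_1,s_2\in\mathbb{R}$ such that $$4k_{zzzz}+4ck_{zz}+4c_zk_z+(2c_{zz}+c^2)k+8(k_{z\bar z}k+k^4-k_zk_{\bar z})k+s_1(2k_{zz}+ck)+s_2k=0.$$
   Context: Everything is smooth. $\mathbb{R}^{4,1}$ is the Lorentzian vector space with inner product $(\cdot,\cdot)$ of signature $(4,1)$ (extended complex bilinearly), $\mathcal{L}$ is its light-cone (non-zero null vectors), and $S^3$ is identified, as a conformal manifold, with $\mathbb{P}(\mathcal{L})$, whose conformal class consists of the metrics $g_\sigma(X,Y)=(\mathrm{d}\sigma(X),\mathrm{d}\sigma(Y))$ for $\sigma$ never-zero sections of $\mathcal{L}\to\mathbb{P}(\mathcal{L})$. $\Sigma$ is a (connected) Riemann surface and $\Lambda:\Sigma\to S^3\cong\mathbb{P}(\mathcal{L})$ is a conformal immersion, viewed as a null line subbundle of $\underline{\mathbb{R}}^{4,1}=\Sigma\times\mathbb{R}^{4,1}$; $\mathrm{d}$ denotes flat differentiation. Identify $\bigwedge^2\mathbb{R}^{4,1}\cong o(\mathbb{R}^{4,1})$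 via $(u\wedge v)w=(u,w)v-(v,w)u$. An isothermic surface $(\Lambda,\eta)$ is such a $\Lambda$ together with a non-zero closed $1$-form $\eta\in\Omega^1\otimes o(\mathbb{R}^{4,1})$ taking values in $\Lambda\wedge\Lambda^\perp$. Given a holomorphic coordinate $z=u+iv$ on $\Sigma$, $\psi\in\Gamma\Lambda$ is the lift, unique up to sign, with $|\mathrm{d}\psi|^2=|\mathrm{d}z|^2$ (i.e. $(\psi_z,\psi_z)=0$, $(\psi_z,\psi_{\bar z})=\tfrac12$). The central sphere congruence is the signature $(3,1)$ subbundle $V\subset\underline{\mathbb{R}}^{4,1}$ with $V\otimes\mathbb{C}=\langle\psi,\psi_z,\psi_{\bar z},\psi_{z\bar z}\rangle$; $V^\perp$ is a line bundle. The Schwarzian derivative $c$ (a complex function) and Hopf differential $\kappa\in\Gamma(V^\perp\otimes\mathbb{C})$ are defined by $\psi_{zz}+\frac c2\psi=\kappa$. When $\eta=-\psi\wedge(\psi_{\bar z}\mathrm{d}z+\psi_z\mathrm{d}\bar z)$, $\kappa$ is real, so $k$ is a real function. $(\Lambda,\eta)$ is special isothermic of type $d$ if there is a polynomial $P(t)=\sum_{i=0}^dP_it^i\in\Gamma(\underline{\mathbb{R}}^{4,1})[t]$ of degree $d$ such that $(\mathrm{d}+t\eta)P(t)\equiv 0$. *)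

theory Defs
  imports "HOL-Analysis.Analysis"
begin

section \<open>The Lorentzian space of signature (4,1)\<close>

text \<open>
  The form is defined over any commutative ring, so that its instance on \<^typ>\<open>complex^5\<close> is the
  complex bilinear (not sesquilinear) extension of its instance on \<^typ>\<open>real^5\<close>.
  The index \<open>5\<close> denotes the same element of the type \<^typ>\<open>5\<close> as \<open>0\<close>; the five indices are distinct.
\<close>

definition lor :: "'a::comm_ring_1 ^ 5 \<Rightarrow> 'a ^ 5 \<Rightarrow> 'a" where
  "lor x y = x $ 1 * y $ 1 + x $ 2 * y $ 2 + x $ 3 * y $ 3 + x $ 4 * y $ 4 - x $ 5 * y $ 5"

definition cvec :: "real ^ 5 \<Rightarrow> complex ^ 5" where
  "cvec x = (\<chi> j. complex_of_real (x $ j))"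

definition wedge :: "'a::comm_ring_1 ^ 5 \<Rightarrow> 'a ^ 5 \<Rightarrow> 'a ^ 5 \<Rightarrow> 'a ^ 5" where
  "wedge u v w = lor u w *s v - lor v w *s u"

definition skew_endomorphisms :: "(real ^ 5 \<Rightarrow> real ^ 5) set" where
  "skew_endomorphisms = {A. linear A \<and> (\<forall>v w. lor (A v) w = - lor v (A w))}"

definition orth :: "(real ^ 5) set \<Rightarrow> (real ^ 5) set" where
  "orth W = {v. \<forall>w\<in>W. lor v w = 0}"

definition light_cone :: "(real ^ 5) set" where
  "light_cone = {x. x \<noteq> 0 \<and> lor x x = 0}"

text \<open>The points of the projectivised light cone, i.e. of the conformal 3-sphere, as null lines.\<close>

definition null_lines :: "(real ^ 5) set set" where
  "null_lines = {span {x} | x. x \<in> light_cone}"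


section \<open>Riemann surfaces with a global holomorphic coordinate\<close>

definition complex_chart :: "'a topology \<Rightarrow> 'a set \<Rightarrow> ('a \<Rightarrow> complex) \<Rightarrow> bool" where
  "complex_chart X U \<phi> \<longleftrightarrow>
     openin X U \<and> open (\<phi> ` U) \<and>
     homeomorphic_map (subtopology X U) (top_of_set (\<phi> ` U)) \<phi>"

definition compatible_charts ::
    "'a set \<Rightarrow> ('a \<Rightarrow> complex) \<Rightarrow> 'a set \<Rightarrow> ('a \<Rightarrow> complex) \<Rightarrow> bool" where
  "compatible_charts U \<phi> U' \<phi>' \<longleftrightarrow>
     (\<phi>' \<circ> inv_into U \<phi>) holomorphic_on \<phi> ` (U \<inter> U') \<and>
     (\<phi> \<circ> inv_into U' \<phi>') holomorphic_on \<phi>' ` (U \<inter> U')"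

text \<open>Second countability is not required: for connected Riemann surfaces it is automatic.\<close>

definition riemann_surface :: "'a topology \<Rightarrow> ('a set \<times> ('a \<Rightarrow> complex)) set \<Rightarrow> bool" where
  "riemann_surface X A \<longleftrightarrow>
     topspace X \<noteq> {} \<and> connected_space X \<and> Hausdorff_space X \<and>
     (\<forall>(U, \<phi>)\<in>A. complex_chart X U \<phi>) \<and>
     topspace X = (\<Union>(U, \<phi>)\<in>A. U) \<and>
     (\<forall>(U, \<phi>)\<in>A. \<forall>(U', \<phi>')\<in>A. compatible_charts U \<phi> U' \<phi>')"

definition holomorphic_coordinate ::
    "'a topology \<Rightarrow> ('a set \<times> ('a \<Rightarrow> complex)) set \<Rightarrow> ('a \<Rightarrow> complex) \<Rightarrow> bool" where
  "holomorphic_coordinate X A z \<longleftrightarrow>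
     complex_chart X (topspace X) z \<and>
     (\<forall>(U, \<phi>)\<in>A. compatible_charts (topspace X) z U \<phi>)"


section \<open>Calculus in the coordinate\<close>

fun C_k_on :: "nat \<Rightarrow> 'a::real_normed_vector set \<Rightarrow> ('a \<Rightarrow> 'b::real_normed_vector) \<Rightarrow> bool" where
  "C_k_on 0 S f \<longleftrightarrow> continuous_on S f"
| "C_k_on (Suc n) S f \<longleftrightarrow>
     (\<forall>x\<in>S. f differentiable (at x)) \<and> (\<forall>v. C_k_on n S (\<lambda>x. frechet_derivative f (at x) v))"

definition C_infinity_on ::
    "'a::real_normed_vector set \<Rightarrow> ('a \<Rightarrow> 'b::real_normed_vector) \<Rightarrow> bool" where
  "C_infinity_on S f \<longleftrightarrow> (\<forall>n. C_k_on n S f)"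

text \<open>
  Functions on the surface are smooth, and are differentiated, through their expression in a global
  holomorphic coordinate \<open>z\<close>, which is a chart of the underlying smooth manifold. The coordinate also
  trivialises the tangent bundle: a tangent vector \<open>Y\<close> at \<open>p\<close> is represented by
  \<open>dz(Y) = \<xi> :: complex\<close>.
\<close>

definition in_coord :: "'a topology \<Rightarrow> ('a \<Rightarrow> complex) \<Rightarrow> ('a \<Rightarrow> 'b) \<Rightarrow> complex \<Rightarrow> 'b" where
  "in_coord X z f = f \<circ> inv_into (topspace X) z"

definition smooth_on ::
    "'a topology \<Rightarrow> ('a \<Rightarrow> complex) \<Rightarrow> 'a set \<Rightarrow> ('a \<Rightarrow> 'b::real_normed_vector) \<Rightarrow> bool" where
  "smooth_on X z W f \<longleftrightarrow> C_infinity_on (z ` W) (in_coord X z f)"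

definition flat_d ::
    "'a topology \<Rightarrow> ('a \<Rightarrow> complex) \<Rightarrow> ('a \<Rightarrow> 'b::real_normed_vector) \<Rightarrow> 'a \<Rightarrow> complex \<Rightarrow> 'b" where
  "flat_d X z f p \<xi> = frechet_derivative (in_coord X z f) (at (z p)) \<xi>"

text \<open>With \<open>z = u + iv\<close>, the directions \<open>1\<close> and \<open>\<i>\<close> are the coordinate fields of \<open>u\<close> and \<open>v\<close>.\<close>

definition d_z :: "'a topology \<Rightarrow> ('a \<Rightarrow> complex) \<Rightarrow> ('a \<Rightarrow> complex) \<Rightarrow> 'a \<Rightarrow> complex" where
  "d_z X z f p = (flat_d X z f p 1 - \<i> * flat_d X z f p \<i>) / 2"

definition d_zbar :: "'a topology \<Rightarrow> ('a \<Rightarrow> complex) \<Rightarrow> ('a \<Rightarrow> complex) \<Rightarrow> 'a \<Rightarrow> complex" where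
  "d_zbar X z f p = (flat_d X z f p 1 + \<i> * flat_d X z f p \<i>) / 2"

definition vec_z ::
    "'a topology \<Rightarrow> ('a \<Rightarrow> complex) \<Rightarrow> ('a \<Rightarrow> complex ^ 5) \<Rightarrow> 'a \<Rightarrow> complex ^ 5" where
  "vec_z X z F p = (\<chi> j. d_z X z (\<lambda>q. F q $ j) p)"

definition vec_zbar ::
    "'a topology \<Rightarrow> ('a \<Rightarrow> complex) \<Rightarrow> ('a \<Rightarrow> complex ^ 5) \<Rightarrow> 'a \<Rightarrow> complex ^ 5" where
  "vec_zbar X z F p = (\<chi> j. d_zbar X z (\<lambda>q. F q $ j) p)"


section \<open>Conformal immersions and isothermic surfaces\<close>

definition section_of ::
    "'a topology \<Rightarrow> ('a \<Rightarrow> complex) \<Rightarrow> ('a \<Rightarrow> (real ^ 5) set) \<Rightarrow> 'a set \<Rightarrow> ('a \<Rightarrow> real ^ 5) \<Rightarrow> bool"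
  where
  "section_of X z \<Lambda> W \<sigma> \<longleftrightarrow> smooth_on X z W \<sigma> \<and> (\<forall>q\<in>W. \<sigma> q \<in> \<Lambda> q)"

text \<open>
  Smoothness of the map \<open>\<Lambda>\<close> into the projectivised light cone is the existence of smooth local lifts.
  For a never-zero lift \<open>\<sigma>\<close>, the pull-back by \<open>\<Lambda>\<close> of the corresponding metric in the conformal class
  of the 3-sphere is \<open>(d\<sigma>, d\<sigma>)\<close>; \<open>\<Lambda>\<close> is a conformal immersion when this is a positive multiple
  of \<open>|dz|\<^sup>2\<close> at each point.
\<close>

definition conformal_immersion ::
    "'a topology \<Rightarrow> ('a \<Rightarrow> complex) \<Rightarrow> ('a \<Rightarrow> (real ^ 5) set) \<Rightarrow> bool" where
  "conformal_immersion X z \<Lambda> \<longleftrightarrow>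
     (\<forall>p\<in>topspace X. \<Lambda> p \<in> null_lines) \<and>
     (\<forall>p\<in>topspace X. \<exists>W \<sigma>. openin X W \<and> p \<in> W \<and> section_of X z \<Lambda> W \<sigma> \<and> (\<forall>q\<in>W. \<sigma> q \<noteq> 0)) \<and>
     (\<forall>W \<sigma>. openin X W \<and> section_of X z \<Lambda> W \<sigma> \<and> (\<forall>q\<in>W. \<sigma> q \<noteq> 0) \<longrightarrow>
        (\<forall>p\<in>W. \<exists>r>0. \<forall>\<xi>. lor (flat_d X z \<sigma> p \<xi>) (flat_d X z \<sigma> p \<xi>) = r * (cmod \<xi>)\<^sup>2))"

text \<open>
  A 1-form with values in the skew endomorphisms is a map \<open>\<eta>\<close>, where \<open>\<eta> p \<xi>\<close> is its value on the
  tangent vector at \<open>p\<close> represented by \<open>\<xi>\<close>.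
\<close>

definition so_one_form ::
    "'a topology \<Rightarrow> ('a \<Rightarrow> complex) \<Rightarrow> ('a \<Rightarrow> complex \<Rightarrow> real ^ 5 \<Rightarrow> real ^ 5) \<Rightarrow> bool" where
  "so_one_form X z \<eta> \<longleftrightarrow>
     (\<forall>p\<in>topspace X. (\<forall>\<xi>. \<eta> p \<xi> \<in> skew_endomorphisms) \<and> (\<forall>w. linear (\<lambda>\<xi>. \<eta> p \<xi> w))) \<and>
     (\<forall>\<xi> w. smooth_on X z (topspace X) (\<lambda>p. \<eta> p \<xi> w))"

text \<open>
  For constant \<open>\<xi>\<close>, \<open>\<zeta>\<close> the corresponding vector fields commute, so that
  \<open>d\<eta>(\<xi>, \<zeta>) = \<xi>(\<eta>(\<zeta>)) - \<zeta>(\<eta>(\<xi>))\<close>.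
\<close>

definition closed_one_form ::
    "'a topology \<Rightarrow> ('a \<Rightarrow> complex) \<Rightarrow> ('a \<Rightarrow> complex \<Rightarrow> real ^ 5 \<Rightarrow> real ^ 5) \<Rightarrow> bool" where
  "closed_one_form X z \<eta> \<longleftrightarrow>
     (\<forall>p\<in>topspace X. \<forall>\<xi> \<zeta> w.
        flat_d X z (\<lambda>q. \<eta> q \<zeta> w) p \<xi> - flat_d X z (\<lambda>q. \<eta> q \<xi> w) p \<zeta> = 0)"

text \<open>As \<open>\<Lambda> p\<close> is a line, every element of \<open>\<Lambda> \<and> \<Lambda>\<^sup>\<bottom>\<close> at \<open>p\<close> is a decomposable bivector.\<close>

definition isothermic_surface ::
    "'a topology \<Rightarrow> ('a \<Rightarrow> complex) \<Rightarrow> ('a \<Rightarrow> (real ^ 5) set) \<Rightarrow>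
     ('a \<Rightarrow> complex \<Rightarrow> real ^ 5 \<Rightarrow> real ^ 5) \<Rightarrow> bool" where
  "isothermic_surface X z \<Lambda> \<eta> \<longleftrightarrow>
     conformal_immersion X z \<Lambda> \<and> so_one_form X z \<eta> \<and> closed_one_form X z \<eta> \<and>
     (\<exists>p\<in>topspace X. \<exists>\<xi> w. \<eta> p \<xi> w \<noteq> 0) \<and>
     (\<forall>p\<in>topspace X. \<forall>\<xi>. \<exists>\<sigma>\<in>\<Lambda> p. \<exists>v\<in>orth (\<Lambda> p). \<eta> p \<xi> = wedge \<sigma> v)"

text \<open>
  The polynomial is \<open>P(t) = (\<Sum>i\<le>d. t\<^sup>i P\<^sub>i)\<close>; having degree \<open>d\<close> means that the section
  \<open>P\<^sub>d\<close> is not identically zero.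
\<close>

definition special_isothermic ::
    "'a topology \<Rightarrow> ('a \<Rightarrow> complex) \<Rightarrow> ('a \<Rightarrow> (real ^ 5) set) \<Rightarrow>
     ('a \<Rightarrow> complex \<Rightarrow> real ^ 5 \<Rightarrow> real ^ 5) \<Rightarrow> nat \<Rightarrow> bool" where
  "special_isothermic X z \<Lambda> \<eta> d \<longleftrightarrow>
     isothermic_surface X z \<Lambda> \<eta> \<and>
     (\<exists>P :: nat \<Rightarrow> 'a \<Rightarrow> real ^ 5.
        (\<forall>i\<le>d. smooth_on X z (topspace X) (P i)) \<and>
        (\<exists>p\<in>topspace X. P d p \<noteq> 0) \<and>
        (\<forall>t::real. \<forall>p\<in>topspace X. \<forall>\<xi>.
           flat_d X z (\<lambda>q. \<Sum>i\<le>d. t ^ i *\<^sub>R P i q) p \<xi>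
             + t *\<^sub>R \<eta> p \<xi> (\<Sum>i\<le>d. t ^ i *\<^sub>R P i p) = 0))"


section \<open>Central sphere congruence, Schwarzian derivative and Hopf differential\<close>

definition normalised_lift ::
    "'a topology \<Rightarrow> ('a \<Rightarrow> complex) \<Rightarrow> ('a \<Rightarrow> (real ^ 5) set) \<Rightarrow> ('a \<Rightarrow> real ^ 5) \<Rightarrow> bool" where
  "normalised_lift X z \<Lambda> \<psi> \<longleftrightarrow>
     section_of X z \<Lambda> (topspace X) \<psi> \<and>
     (\<forall>p\<in>topspace X. \<forall>\<xi>. lor (flat_d X z \<psi> p \<xi>) (flat_d X z \<psi> p \<xi>) = (cmod \<xi>)\<^sup>2)"

text \<open>The real vectors in the complex span, which is invariant under conjugation.\<close>

definition central_sphere ::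
    "'a topology \<Rightarrow> ('a \<Rightarrow> complex) \<Rightarrow> ('a \<Rightarrow> real ^ 5) \<Rightarrow> 'a \<Rightarrow> (real ^ 5) set" where
  "central_sphere X z \<psi> p =
     (let \<Psi> = (\<lambda>q. cvec (\<psi> q)) in
      {v. cvec v \<in> vec.span {\<Psi> p, vec_z X z \<Psi> p, vec_zbar X z \<Psi> p, vec_zbar X z (vec_z X z \<Psi>) p}})"

definition schwarzian_hopf ::
    "'a topology \<Rightarrow> ('a \<Rightarrow> complex) \<Rightarrow> ('a \<Rightarrow> real ^ 5) \<Rightarrow>
     ('a \<Rightarrow> complex) \<Rightarrow> ('a \<Rightarrow> complex ^ 5) \<Rightarrow> bool" where
  "schwarzian_hopf X z \<psi> c \<kappa> \<longleftrightarrow>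
     smooth_on X z (topspace X) c \<and> smooth_on X z (topspace X) \<kappa> \<and>
     (\<forall>p\<in>topspace X.
        \<kappa> p \<in> vec.span (cvec ` orth (central_sphere X z \<psi> p)) \<and>
        vec_z X z (vec_z X z (\<lambda>q. cvec (\<psi> q))) p + (c p / 2) *s cvec (\<psi> p) = \<kappa> p)"

text \<open>
  The real form \<open>- \<psi> \<and> (\<psi>\<^sub>z\<^sub>b\<^sub>a\<^sub>r dz + \<psi>\<^sub>z dzbar)\<close>; on the tangent vector \<open>\<xi>\<close>, \<open>dz\<close> and
  \<open>dzbar\<close> take the values \<open>\<xi>\<close> and \<open>cnj \<xi>\<close>.
\<close>

definition eta_of_coordinate ::
    "'a topology \<Rightarrow> ('a \<Rightarrow> complex) \<Rightarrow> ('a \<Rightarrow> real ^ 5) \<Rightarrow>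
     ('a \<Rightarrow> complex \<Rightarrow> real ^ 5 \<Rightarrow> real ^ 5) \<Rightarrow> bool" where
  "eta_of_coordinate X z \<psi> \<eta> \<longleftrightarrow>
     (let \<Psi> = (\<lambda>q. cvec (\<psi> q)) in
      \<forall>p\<in>topspace X. \<forall>\<xi> w.
        cvec (\<eta> p \<xi> w) =
          - wedge (\<Psi> p) (\<xi> *s vec_zbar X z \<Psi> p + cnj \<xi> *s vec_z X z \<Psi> p) (cvec w))"

end

theory Submission
  imports Defs
begin

text \<open>
  Write subscripts for the Wirtinger derivatives. Separating powers of \<open>t\<close> in
  \<open>(d + t\<eta>)(P\<^sub>0 + t P\<^sub>1 + t\<^sup>2 P\<^sub>2) = 0\<close> gives a ladder
  \<open>dP\<^sub>0 = 0\<close>, \<open>dP\<^sub>1 = - \<eta> P\<^sub>0\<close>, \<open>dP\<^sub>2 = - \<eta> P\<^sub>1\<close>, \<open>\<eta> P\<^sub>2 = 0\<close>, and since everything is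
  real it suffices to look at \<open>dz\<close>-parts.

  The idea is that each rung is governed by two scalars. The fields \<open>\<psi>\<close>, \<open>\<psi>\<^sub>z\<close>, \<open>\<psi>\<^sub>z\<^sub>b\<^sub>a\<^sub>r\<close>, the mixed
  derivative of \<open>\<psi>\<close>, and \<open>N\<close> form a frame, and if \<open>dP = - \<eta> Q\<close> then the products of \<open>P\<close> with the
  frame are derivatives of \<open>f = (P, \<psi>)\<close>, together with \<open>m = (P, N)\<close>. The structure equations of the
  frame turn \<open>dP = - \<eta> Q\<close> into
    \<open>m\<^sub>z = 2 (f k\<^sub>z\<^sub>b\<^sub>a\<^sub>r - k f\<^sub>z\<^sub>b\<^sub>a\<^sub>r)\<close> and \<open>2 f\<^sub>z\<^sub>z + c f - 2 m k = (Q, \<psi>)\<close>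
  (\<open>ladder_scalars\<close>). Conversely these two equations suffice: \<open>f\<close> and \<open>m\<close> determine a section, and
  by the Gauss equation it satisfies the rung (\<open>ladder_frame_section\<close>).

  Now go down from \<open>P\<^sub>2\<close>. The equation \<open>\<eta> P\<^sub>2 = 0\<close> gives \<open>f\<^sub>2 = 0\<close>, so \<open>m\<^sub>2 = g\<close> is a constant, non-zero
  because otherwise \<open>P\<^sub>2 = 0\<close>. Then \<open>f\<^sub>1 = - 2 g k\<close> and \<open>m\<^sub>1 = n\<close> is a constant. Then
  \<open>f\<^sub>0 = - 2 g \<delta> - 2 n k\<close> with \<open>\<delta> = 2 k\<^sub>z\<^sub>z + c k\<close>, which the Codazzi equation makes real, and \<open>m\<^sub>0\<close> has
  \<open>z\<close>-derivative \<open>4 g (k \<delta>\<^sub>z\<^sub>b\<^sub>a\<^sub>r - \<delta> k\<^sub>z\<^sub>b\<^sub>a\<^sub>r)\<close>. The bracket has the explicit primitive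
  \<open>\<mu> = 2 (k\<^sub>z\<^sub>z\<^sub>b\<^sub>a\<^sub>r k + k\<^sup>4 - k\<^sub>z k\<^sub>z\<^sub>b\<^sub>a\<^sub>r)\<close>, so \<open>m\<^sub>0 = 4 g \<mu> + m\<close> with a constant \<open>m\<close>; in the converse
  direction, this is why no period of a 1-form can obstruct the construction on a surface that is
  not simply connected. The last rung \<open>2 (f\<^sub>0)\<^sub>z\<^sub>z + c f\<^sub>0 - 2 m\<^sub>0 k = 0\<close> is \<open>- 2 g\<close> times
    \<open>2 \<delta>\<^sub>z\<^sub>z + c \<delta> + 4 \<mu> k + (n/g) \<delta> + (m/g) k = 0\<close>,
  which is the asserted equation with \<open>s\<^sub>1 = n/g\<close> and \<open>s\<^sub>2 = m/g\<close>.
\<close>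

section \<open>Smooth functions on open sets\<close>

lemma frechet_derivative_cong_open:
  assumes "open S" and "x \<in> S" and "\<And>y. y \<in> S \<Longrightarrow> f y = g y"
  shows "frechet_derivative f (at x) = frechet_derivative g (at x)"
proof -
  have "(f has_derivative F) (at x) \<longleftrightarrow> (g has_derivative F) (at x)" for F
    using has_derivative_transform_within_open[of f F x UNIV S g]
      has_derivative_transform_within_open[of g F x UNIV S f] assms by auto
  then show ?thesis by (simp add: frechet_derivative_def)
qed

lemma differentiable_cong_open:
  assumes "open S" and "x \<in> S" and "\<And>y. y \<in> S \<Longrightarrow> f y = g y" and "f differentiable (at x)"
  shows "g differentiable (at x)"
  using assms has_derivative_transform_within_open unfolding differentiable_def by blast

lemma C_k_on_cong:
  assumes "open S" and "\<And>x. x \<in> S \<Longrightarrow> f x = g x" and "C_k_on n S f"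
  shows "C_k_on n S g"
  using assms(2,3)
proof (induction n arbitrary: f g)
  case 0
  then show ?case using continuous_on_cong[OF refl, of S f g] unfolding C_k_on.simps by blast
next
  case (Suc n)
  have "C_k_on n S (\<lambda>x. frechet_derivative g (at x) v)" for v
    by (rule Suc.IH[of "\<lambda>x. frechet_derivative f (at x) v"])
       (use Suc.prems frechet_derivative_cong_open[OF assms(1), of _ f g] in simp_all)
  then show ?case
    using Suc.prems differentiable_cong_open[OF assms(1), of _ f g] by auto
qed

lemma C_k_on_imp_continuous: "C_k_on n S f \<Longrightarrow> continuous_on S f"
  by (cases n) (auto intro: differentiable_imp_continuous_on simp: differentiable_on_def
      differentiable_at_withinI)

lemma C_k_on_SucD: "C_k_on (Suc n) S f \<Longrightarrow> C_k_on n S f"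
proof (induction n arbitrary: f)
  case 0
  then show ?case using C_k_on_imp_continuous[of "Suc 0" S f] by simp
next
  case (Suc n)
  then show ?case by (metis C_k_on.simps(2))
qed

lemma C_k_on_const: "C_k_on n S (\<lambda>x. c)"
  by (induction n arbitrary: c) auto

lemma C_k_on_bounded_linear:
  assumes "open S" and "bounded_linear L" and "C_k_on n S f"
  shows "C_k_on n S (\<lambda>x. L (f x))"
  using assms(3)
proof (induction n arbitrary: f)
  case 0
  then show ?case by (simp add: bounded_linear.continuous_on[OF assms(2)])
next
  case (Suc n)
  have der: "((\<lambda>x. L (f x)) has_derivative (\<lambda>v. L (frechet_derivative f (at x) v))) (at x)"
    if "x \<in> S" for x
    using Suc.prems that bounded_linear.has_derivative[OF assms(2)]
    by (auto simp: frechet_derivative_works)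
  have "C_k_on n S (\<lambda>x. frechet_derivative (\<lambda>x. L (f x)) (at x) v)" for v
    by (rule C_k_on_cong[OF assms(1) _ Suc.IH[of "\<lambda>x. frechet_derivative f (at x) v"]])
       (use Suc.prems in \<open>simp_all add: frechet_derivative_at[OF der, symmetric]\<close>)
  then show ?case using der by (auto simp: differentiable_def)
qed

lemma C_k_on_add:
  assumes "open S" and "C_k_on n S f" and "C_k_on n S g"
  shows "C_k_on n S (\<lambda>x. f x + g x)"
  using assms(2,3)
proof (induction n arbitrary: f g)
  case 0
  then show ?case by (simp add: continuous_on_add)
next
  case (Suc n)
  have der: "((\<lambda>x. f x + g x) has_derivative
      (\<lambda>v. frechet_derivative f (at x) v + frechet_derivative g (at x) v)) (at x)"
    if "x \<in> S" for x
    using Suc.prems that by (intro has_derivative_add) (auto simp: frechet_derivative_works)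
  have "C_k_on n S (\<lambda>x. frechet_derivative (\<lambda>x. f x + g x) (at x) v)" for v
    by (rule C_k_on_cong[OF assms(1) _ Suc.IH[of "\<lambda>x. frechet_derivative f (at x) v"
      "\<lambda>x. frechet_derivative g (at x) v"]]) (use Suc.prems in \<open>simp_all add: frechet_derivative_at[OF der, symmetric]\<close>)
  then show ?case using der by (auto simp: differentiable_def)
qed

lemma C_k_on_mult:
  fixes f g :: "'a::real_normed_vector \<Rightarrow> 'b::real_normed_algebra"
  assumes "open S" and "C_k_on n S f" and "C_k_on n S g"
  shows "C_k_on n S (\<lambda>x. f x * g x)"
  using assms(2,3)
proof (induction n arbitrary: f g)
  case 0
  then show ?case by (simp add: continuous_on_mult)
next
  case (Suc n)
  have der: "((\<lambda>x. f x * g x) has_derivative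
      (\<lambda>v. f x * frechet_derivative g (at x) v + frechet_derivative f (at x) v * g x)) (at x)"
    if "x \<in> S" for x
    using Suc.prems that by (intro has_derivative_mult) (auto simp: frechet_derivative_works)
  have "C_k_on n S (\<lambda>x. f x * frechet_derivative g (at x) v + frechet_derivative f (at x) v * g x)"
    for v
    using Suc.prems C_k_on_SucD[OF Suc.prems(1)] C_k_on_SucD[OF Suc.prems(2)]
    by (intro C_k_on_add[OF assms(1)] Suc.IH) simp_all
  then have "C_k_on n S (\<lambda>x. frechet_derivative (\<lambda>x. f x * g x) (at x) v)" for v
    by (rule C_k_on_cong[OF assms(1), rotated]) (use Suc.prems in \<open>simp_all add: frechet_derivative_at[OF der, symmetric]\<close>)
  then show ?case using der by (auto simp: differentiable_def)
qed

lemma C_infinity_on_cong: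
  assumes "open S" and "\<And>x. x \<in> S \<Longrightarrow> f x = g x" and "C_infinity_on S f"
  shows "C_infinity_on S g"
proof -
  have "C_k_on n S g" for n
    by (rule C_k_on_cong[OF assms(1,2)]) (use assms(3) in \<open>simp_all add: C_infinity_on_def\<close>)
  then show ?thesis by (simp add: C_infinity_on_def)
qed

lemma C_infinity_on_differentiable:
  assumes "C_infinity_on S f" and "x \<in> S"
  shows "f differentiable (at x)"
  using assms C_k_on.simps(2)[of 0 S f] unfolding C_infinity_on_def by blast

lemma C_infinity_on_derivative:
  assumes "C_infinity_on S f"
  shows "C_infinity_on S (\<lambda>x. frechet_derivative f (at x) v)"
  using assms C_k_on.simps(2)[of _ S f] unfolding C_infinity_on_def by blast

text \<open>
  The mean value theorem applied to \<open>s \<mapsto> f (a + s v + h w) - f (a + s v)\<close> and then along \<open>w\<close>. The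
  left-hand side is symmetric in \<open>v\<close> and \<open>w\<close>, which yields the symmetry of second derivatives.
\<close>

lemma second_difference_mean_value:
  fixes f :: "'a::real_normed_vector \<Rightarrow> real"
  assumes "h > 0"
    and df: "\<And>s t. 0 \<le> s \<Longrightarrow> s \<le> h \<Longrightarrow> 0 \<le> t \<Longrightarrow> t \<le> h \<Longrightarrow>
      f differentiable (at (a + s *\<^sub>R v + t *\<^sub>R w))"
    and ddf: "\<And>s t. 0 \<le> s \<Longrightarrow> s \<le> h \<Longrightarrow> 0 \<le> t \<Longrightarrow> t \<le> h \<Longrightarrow>
      (\<lambda>x. frechet_derivative f (at x) v) differentiable (at (a + s *\<^sub>R v + t *\<^sub>R w))"
  obtains s t where "0 \<le> s" "s \<le> h" "0 \<le> t" "t \<le> h"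
    "f (a + h *\<^sub>R v + h *\<^sub>R w) - f (a + h *\<^sub>R v) - f (a + h *\<^sub>R w) + f a
      = h\<^sup>2 * frechet_derivative (\<lambda>x. frechet_derivative f (at x) v) (at (a + s *\<^sub>R v + t *\<^sub>R w)) w"
proof -
  let ?fv = "\<lambda>x. frechet_derivative f (at x) v"
  let ?g = "\<lambda>s. f (a + s *\<^sub>R v + h *\<^sub>R w) - f (a + s *\<^sub>R v + 0 *\<^sub>R w)"
  have line: "((\<lambda>s. f (a + s *\<^sub>R v + t *\<^sub>R w)) has_derivative
      (\<lambda>r. r * ?fv (a + s *\<^sub>R v + t *\<^sub>R w))) (at s)"
    if "0 \<le> s" "s \<le> h" "0 \<le> t" "t \<le> h" for s t
  proof -
    have "((\<lambda>s. a + s *\<^sub>R v + t *\<^sub>R w) has_derivative (\<lambda>r. r *\<^sub>R v)) (at s)"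
      by (auto intro!: derivative_eq_intros)
    from has_derivative_compose[OF this df[OF that, unfolded frechet_derivative_works]]
    show ?thesis
      using linear_frechet_derivative[OF df[OF that]] by (simp add: linear_cmul)
  qed
  have "(?g has_derivative (\<lambda>r. r * ?fv (a + s *\<^sub>R v + h *\<^sub>R w) - r * ?fv (a + s *\<^sub>R v + 0 *\<^sub>R w)))
      (at s within {0..h})" if "0 \<le> s" "s \<le> h" for s
    by (rule has_derivative_at_withinI, intro has_derivative_diff line) (use that \<open>h > 0\<close> in simp_all)
  from mvt_simple[OF \<open>h > 0\<close> this] obtain s where s: "0 \<le> s" "s \<le> h"
    and gs: "?g h - ?g 0 = (h - 0) * ?fv (a + s *\<^sub>R v + h *\<^sub>R w) - (h - 0) * ?fv (a + s *\<^sub>R v + 0 *\<^sub>R w)"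
    using less_imp_le by (metis (no_types, lifting) greaterThanLessThan_iff)
  let ?k = "\<lambda>t. ?fv (a + s *\<^sub>R v + t *\<^sub>R w)"
  have "(?k has_derivative (\<lambda>r. r * frechet_derivative ?fv (at (a + s *\<^sub>R v + t *\<^sub>R w)) w)) (at t within {0..h})"
    if "0 \<le> t" "t \<le> h" for t
  proof -
    have "((\<lambda>t. a + s *\<^sub>R v + t *\<^sub>R w) has_derivative (\<lambda>r. r *\<^sub>R w)) (at t within {0..h})"
      by (auto intro!: derivative_eq_intros)
    from has_derivative_compose[OF this ddf[OF s that, unfolded frechet_derivative_works]]
    show ?thesis
      using linear_frechet_derivative[OF ddf[OF s that]] by (simp add: linear_cmul)
  qed
  from mvt_simple[OF \<open>h > 0\<close> this] obtain t where t: "0 \<le> t" "t \<le> h"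
    and kt: "?k h - ?k 0 = (h - 0) * frechet_derivative ?fv (at (a + s *\<^sub>R v + t *\<^sub>R w)) w"
    using less_imp_le by (metis (no_types, lifting) greaterThanLessThan_iff)
  have "?g h - ?g 0 = h * (?k h - ?k 0)"
    using gs by (simp add: right_diff_distrib)
  also have "\<dots> = h\<^sup>2 * frechet_derivative ?fv (at (a + s *\<^sub>R v + t *\<^sub>R w)) w"
    unfolding kt by (simp add: power2_eq_square)
  finally show ?thesis
    using that[OF s t] by simp
qed

text \<open>
  If the two values differed, continuity would keep the two mixed derivatives apart near \<open>a\<close>; but on
  a small parallelogram both of them take, somewhere, the value of the same second difference.
\<close>

lemma second_derivative_symmetric_real:
  fixes f :: "'a::real_normed_vector \<Rightarrow> real"
  assumes "open S" and "C_k_on 2 S f" and "a \<in> S"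
  shows "frechet_derivative (\<lambda>x. frechet_derivative f (at x) v) (at a) w
       = frechet_derivative (\<lambda>x. frechet_derivative f (at x) w) (at a) v"
proof (rule ccontr)
  define F where "F v w x = frechet_derivative (\<lambda>x. frechet_derivative f (at x) v) (at x) w" for v w x
  assume ne: "\<not> ?thesis"
  define e where "e = \<bar>F v w a - F w v a\<bar> / 2"
  have "e > 0"
    using ne by (simp add: e_def F_def)
  have C: "C_k_on (Suc (Suc 0)) S f"
    using assms(2) by (simp add: numeral_2_eq_2)
  have df: "f differentiable (at x)"
    and ddf: "(\<lambda>x. frechet_derivative f (at x) v) differentiable (at x)" if "x \<in> S" for x v
    using C that by simp_all
  have "isCont (F v w) a" for v w
    using C assms(1,3) by (simp add: F_def[abs_def] continuous_on_eq_continuous_at)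
  then have "(F v w \<longlongrightarrow> F v w a) (nhds a)" for v w
    by (simp add: tendsto_at_iff_tendsto_nhds isCont_def)
  then have "\<forall>\<^sub>F x in nhds a. x \<in> S \<and> dist (F v w x) (F v w a) < e \<and> dist (F w v x) (F w v a) < e"
    using \<open>e > 0\<close> assms(1,3) by (intro eventually_conj tendstoD eventually_nhds_in_open)
  then obtain d where "d > 0" and d: "\<And>x. dist x a < d \<Longrightarrow>
      x \<in> S \<and> dist (F v w x) (F v w a) < e \<and> dist (F w v x) (F w v a) < e"
    unfolding eventually_nhds_metric by blast
  define h where "h = d / (norm v + norm w + 1)"
  have "h > 0"
    using \<open>d > 0\<close> by (simp add: h_def add_nonneg_pos)
  have near: "dist (a + s *\<^sub>R v + t *\<^sub>R w) a < d"
    if "0 \<le> s" "s \<le> h" "0 \<le> t" "t \<le> h" for s t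
  proof -
    have "dist (a + s *\<^sub>R v + t *\<^sub>R w) a = norm (s *\<^sub>R v + t *\<^sub>R w)"
      by (simp add: dist_norm algebra_simps)
    also have "\<dots> \<le> s * norm v + t * norm w"
      using norm_triangle_ineq[of "s *\<^sub>R v" "t *\<^sub>R w"] that by simp
    also have "\<dots> \<le> h * (norm v + norm w)"
      using that by (simp add: distrib_left add_mono mult_right_mono)
    also have "\<dots> < h * (norm v + norm w + 1)"
      using \<open>h > 0\<close> by simp
    also have "\<dots> = d"
      by (simp add: h_def add_nonneg_pos less_imp_neq[symmetric])
    finally show ?thesis .
  qed
  have near': "dist (a + s *\<^sub>R w + t *\<^sub>R v) a < d"
    if "0 \<le> s" "s \<le> h" "0 \<le> t" "t \<le> h" for s t
    using near[OF that(3,4,1,2)] by (simp add: algebra_simps)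
  note nearS = d[OF near, THEN conjunct1] and nearS' = d[OF near', THEN conjunct1]
  obtain s t where r: "0 \<le> s" "s \<le> h" "0 \<le> t" "t \<le> h"
    and st: "f (a + h *\<^sub>R v + h *\<^sub>R w) - f (a + h *\<^sub>R v) - f (a + h *\<^sub>R w) + f a
      = h\<^sup>2 * F v w (a + s *\<^sub>R v + t *\<^sub>R w)"
    unfolding F_def
    by (rule second_difference_mean_value[OF \<open>h > 0\<close> df[OF nearS] ddf[OF nearS]]; (assumption | rule that))
  obtain s' t' where r': "0 \<le> s'" "s' \<le> h" "0 \<le> t'" "t' \<le> h"
    and st': "f (a + h *\<^sub>R w + h *\<^sub>R v) - f (a + h *\<^sub>R w) - f (a + h *\<^sub>R v) + f a
      = h\<^sup>2 * F w v (a + s' *\<^sub>R w + t' *\<^sub>R v)"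
    unfolding F_def
    by (rule second_difference_mean_value[OF \<open>h > 0\<close> df[OF nearS'] ddf[OF nearS']]; (assumption | rule that))
  have swap: "a + h *\<^sub>R w + h *\<^sub>R v = a + h *\<^sub>R v + h *\<^sub>R w"
    by simp
  from st st'[unfolded swap] have "h\<^sup>2 * F v w (a + s *\<^sub>R v + t *\<^sub>R w) = h\<^sup>2 * F w v (a + s' *\<^sub>R w + t' *\<^sub>R v)"
    by linarith
  then have "F v w (a + s *\<^sub>R v + t *\<^sub>R w) = F w v (a + s' *\<^sub>R w + t' *\<^sub>R v)"
    using \<open>h > 0\<close> by simp
  moreover have "\<bar>F v w (a + s *\<^sub>R v + t *\<^sub>R w) - F v w a\<bar> < e"
    and "\<bar>F w v (a + s' *\<^sub>R w + t' *\<^sub>R v) - F w v a\<bar> < e"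
    using d[OF near[OF r]] d[OF near'[OF r']] by (simp_all add: dist_real_def)
  ultimately show False
    by (simp add: e_def abs_if split: if_splits)
qed

lemma second_derivative_symmetric:
  fixes f :: "'a::real_normed_vector \<Rightarrow> complex"
  assumes "open S" and "C_k_on 2 S f" and "a \<in> S"
  shows "frechet_derivative (\<lambda>x. frechet_derivative f (at x) v) (at a) w
       = frechet_derivative (\<lambda>x. frechet_derivative f (at x) w) (at a) v"
proof -
  have C: "C_k_on (Suc (Suc 0)) S f"
    using assms(2) by (simp add: numeral_2_eq_2)
  have L: "frechet_derivative (\<lambda>x. frechet_derivative (\<lambda>x. L (f x)) (at x) v) (at a) w
      = L (frechet_derivative (\<lambda>x. frechet_derivative f (at x) v) (at a) w)"
    if L: "bounded_linear L" for L :: "complex \<Rightarrow> real" and v w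
  proof -
    have D: "frechet_derivative (\<lambda>x. L (g x)) (at x) v = L (frechet_derivative g (at x) v)"
      if "g differentiable (at x)" for g :: "'a \<Rightarrow> complex" and x v
      using bounded_linear.has_derivative[OF L, of g "frechet_derivative g (at x)" "at x"] that
      by (metis frechet_derivative_at frechet_derivative_works)
    have "frechet_derivative (\<lambda>x. frechet_derivative (\<lambda>x. L (f x)) (at x) v) (at a)
        = frechet_derivative (\<lambda>x. L (frechet_derivative f (at x) v)) (at a)"
      using C D assms(1,3) by (intro frechet_derivative_cong_open[of S]) simp_all
    then show ?thesis
      using C D[of "\<lambda>x. frechet_derivative f (at x) v" a w] assms(3) by simp
  qed
  have "L (frechet_derivative (\<lambda>x. frechet_derivative f (at x) v) (at a) w)
      = L (frechet_derivative (\<lambda>x. frechet_derivative f (at x) w) (at a) v)"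
    if "bounded_linear L" for L :: "complex \<Rightarrow> real"
    using second_derivative_symmetric_real[OF assms(1) C_k_on_bounded_linear[OF assms(1) that assms(2)] assms(3)]
      L[OF that] by simp
  then show ?thesis
    using bounded_linear_Re bounded_linear_Im complex_eqI by blast
qed

section \<open>Wirtinger calculus in a global coordinate\<close>

text \<open>
  Differentiation sees a function only through its values on the surface, so an equation that holds
  there may be differentiated; the values elsewhere are arbitrary. The \<open>_cong\<close> lemmas below express
  this, and they carry the steps from an equation to its derivatives.
\<close>

locale coordinate_surface =
  fixes X :: "'a topology" and z :: "'a \<Rightarrow> complex"
  assumes chart: "complex_chart X (topspace X) z"
    and connected: "connected_space X"
begin

abbreviation "S \<equiv> topspace X"
abbreviation "sm \<equiv> smooth_on X z (topspace X)"
abbreviation "dd \<equiv> flat_d X z"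
abbreviation "dz \<equiv> d_z X z"
abbreviation "dzb \<equiv> d_zbar X z"

lemma open_image: "open (z ` S)"
  using chart by (simp add: complex_chart_def)

lemma homeomorphic: "homeomorphic_map X (top_of_set (z ` S)) z"
  using chart by (simp add: complex_chart_def)

lemma inv_coord: "p \<in> S \<Longrightarrow> inv_into S z (z p) = p"
  using homeomorphic_imp_injective_map[OF homeomorphic] by simp

lemma in_coord_at: "p \<in> S \<Longrightarrow> in_coord X z f (z p) = f p"
  by (simp add: in_coord_def inv_coord)

lemma connected_image: "connected (z ` S)"
  using homeomorphic_map_connectedness[OF homeomorphic, of S] connected
  by (simp add: connectedin_topspace connectedin_subtopology)

lemma in_coord_cong:
  assumes "\<And>q. q \<in> S \<Longrightarrow> f q = g q" and "x \<in> z ` S"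
  shows "in_coord X z f x = in_coord X z g x"
  using assms by (auto simp: in_coord_at)

lemma flat_d_cong:
  assumes "\<And>q. q \<in> S \<Longrightarrow> f q = g q" and "p \<in> S"
  shows "dd f p = dd g p"
  unfolding flat_d_def
  by (intro ext fun_cong[OF frechet_derivative_cong_open[OF open_image]])
     (use assms in \<open>auto intro: in_coord_cong\<close>)

lemma has_derivative_flat_d:
  assumes "sm f" and "p \<in> S"
  shows "(in_coord X z f has_derivative dd f p) (at (z p))"
  using C_infinity_on_differentiable[of "z ` S" "in_coord X z f" "z p"] assms
  by (simp add: smooth_on_def frechet_derivative_works flat_d_def[abs_def])

lemma flat_d_eqI:
  assumes "(in_coord X z f has_derivative F) (at (z p))"
  shows "dd f p = F"
  using frechet_derivative_at[OF assms] by (simp add: flat_d_def[abs_def])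

lemma in_coord_comp: "in_coord X z (\<lambda>q. h (f q)) = (\<lambda>x. h (in_coord X z f x))"
  by (simp add: in_coord_def o_def)

lemma in_coord_comp2: "in_coord X z (\<lambda>q. h (f q) (g q)) = (\<lambda>x. h (in_coord X z f x) (in_coord X z g x))"
  by (simp add: in_coord_def o_def)

lemma smooth_flat_d:
  assumes "sm f" shows "sm (\<lambda>q. dd f q v)"
proof -
  have "C_infinity_on (z ` S) (\<lambda>x. frechet_derivative (in_coord X z f) (at x) v)"
    using assms C_infinity_on_derivative by (simp add: smooth_on_def)
  moreover have "frechet_derivative (in_coord X z f) (at x) v = in_coord X z (\<lambda>q. dd f q v) x"
    if "x \<in> z ` S" for x
    using that by (auto simp: in_coord_at flat_d_def)
  ultimately show ?thesis
    unfolding smooth_on_def by (rule C_infinity_on_cong[OF open_image, rotated])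
qed

lemma smooth_const: "sm (\<lambda>q. c)"
  by (simp add: smooth_on_def C_infinity_on_def C_k_on_const in_coord_def o_def)

lemma smooth_add: "sm f \<Longrightarrow> sm g \<Longrightarrow> sm (\<lambda>q. f q + g q)"
  by (simp add: smooth_on_def C_infinity_on_def in_coord_comp2 C_k_on_add open_image)

lemma smooth_mult:
  fixes f g :: "'a \<Rightarrow> 'b::real_normed_algebra"
  shows "sm f \<Longrightarrow> sm g \<Longrightarrow> sm (\<lambda>q. f q * g q)"
  by (simp add: smooth_on_def C_infinity_on_def in_coord_comp2 C_k_on_mult open_image)

lemma smooth_bounded_linear: "bounded_linear L \<Longrightarrow> sm f \<Longrightarrow> sm (\<lambda>q. L (f q))"
  by (simp add: smooth_on_def C_infinity_on_def in_coord_comp C_k_on_bounded_linear open_image)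

lemma smooth_sum:
  assumes "\<And>i. i \<in> I \<Longrightarrow> sm (f i)"
  shows "sm (\<lambda>q. \<Sum>i\<in>I. f i q)"
  using assms by (induction I rule: infinite_finite_induct) (auto intro: smooth_add smooth_const)

lemma smooth_minus: "sm f \<Longrightarrow> sm (\<lambda>q. - f q)"
  using smooth_bounded_linear[OF bounded_linear_minus[OF bounded_linear_ident]] .

lemma smooth_diff: "sm f \<Longrightarrow> sm g \<Longrightarrow> sm (\<lambda>q. f q - g q)"
  using smooth_add[OF _ smooth_minus, of f g] by simp

lemma smooth_power:
  fixes f :: "'a \<Rightarrow> 'b::{real_normed_algebra,monoid_mult}"
  shows "sm f \<Longrightarrow> sm (\<lambda>q. f q ^ n)"
  by (induction n) (simp_all add: smooth_const smooth_mult)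

lemma smooth_cnj: "sm f \<Longrightarrow> sm (\<lambda>q. cnj (f q))"
  by (rule smooth_bounded_linear[OF bounded_linear_cnj])

lemma smooth_divide: "sm f \<Longrightarrow> sm (\<lambda>q. f q / c)" for c :: complex
  by (rule smooth_bounded_linear[OF bounded_linear_divide])

lemma smooth_dz: "sm f \<Longrightarrow> sm (dz f)" and smooth_dzb: "sm f \<Longrightarrow> sm (dzb f)"
  unfolding d_z_def[abs_def] d_zbar_def[abs_def]
  by (intro smooth_divide smooth_diff smooth_add smooth_mult smooth_const smooth_flat_d; assumption)+

lemmas smooth_intros =
  smooth_const smooth_add smooth_mult smooth_minus smooth_diff smooth_power smooth_cnj smooth_divide
  smooth_dz smooth_dzb

lemma flat_d_bounded_linear:
  assumes "bounded_linear L" and "sm f" and "p \<in> S"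
  shows "dd (\<lambda>q. L (f q)) p = (\<lambda>v. L (dd f p v))"
  by (rule flat_d_eqI, subst in_coord_comp)
     (rule bounded_linear.has_derivative[OF assms(1) has_derivative_flat_d[OF assms(2,3)]])

lemma flat_d_add:
  assumes "sm f" and "sm g" and "p \<in> S"
  shows "dd (\<lambda>q. f q + g q) p = (\<lambda>v. dd f p v + dd g p v)"
  using has_derivative_flat_d assms
  by (intro flat_d_eqI, subst in_coord_comp2) (intro has_derivative_add, auto)

lemma flat_d_mult:
  fixes f g :: "'a \<Rightarrow> 'b::real_normed_algebra"
  assumes "sm f" and "sm g" and "p \<in> S"
  shows "dd (\<lambda>q. f q * g q) p = (\<lambda>v. f p * dd g p v + dd f p v * g p)"
  using has_derivative_mult[OF has_derivative_flat_d[OF assms(1,3)] has_derivative_flat_d[OF assms(2,3)]]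
  by (intro flat_d_eqI, subst in_coord_comp2) (simp add: in_coord_at assms(3))

lemma flat_d_const: "dd (\<lambda>q. c) p = (\<lambda>v. 0)"
  by (rule flat_d_eqI) (simp add: in_coord_def o_def)

lemma linear_flat_d:
  assumes "sm f" and "p \<in> S"
  shows "linear (dd f p)"
  using has_derivative_flat_d[OF assms] has_derivative_linear by blast

lemma wirtinger_cong:
  assumes "\<And>q. q \<in> S \<Longrightarrow> f q = g q" and "p \<in> S"
  shows "dz f p = dz g p" and "dzb f p = dzb g p"
  using flat_d_cong[OF assms] by (simp_all add: d_z_def d_zbar_def)

lemma wirtinger_add:
  assumes "sm f" and "sm g" and "p \<in> S"
  shows "dz (\<lambda>q. f q + g q) p = dz f p + dz g p" and "dzb (\<lambda>q. f q + g q) p = dzb f p + dzb g p"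
  by (simp_all add: d_z_def d_zbar_def flat_d_add[OF assms] field_simps)

lemma wirtinger_mult:
  assumes "sm f" and "sm g" and "p \<in> S"
  shows "dz (\<lambda>q. f q * g q) p = f p * dz g p + dz f p * g p"
    and "dzb (\<lambda>q. f q * g q) p = f p * dzb g p + dzb f p * g p"
  by (simp_all add: d_z_def d_zbar_def flat_d_mult[OF assms] field_simps)

lemma wirtinger_const:
  shows "dz (\<lambda>q. c) p = 0" and "dzb (\<lambda>q. c) p = 0"
  by (simp_all add: d_z_def d_zbar_def flat_d_const)

lemma wirtinger_minus:
  assumes "sm f" and "p \<in> S"
  shows "dz (\<lambda>q. - f q) p = - dz f p" and "dzb (\<lambda>q. - f q) p = - dzb f p"
  using wirtinger_mult[OF smooth_const assms, of "-1"] by (simp_all add: wirtinger_const)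

lemma wirtinger_diff:
  assumes "sm f" and "sm g" and "p \<in> S"
  shows "dz (\<lambda>q. f q - g q) p = dz f p - dz g p" and "dzb (\<lambda>q. f q - g q) p = dzb f p - dzb g p"
  using wirtinger_add[OF assms(1) smooth_minus[OF assms(2)] assms(3)] wirtinger_minus[OF assms(2,3)]
  by simp_all

lemma wirtinger_divide:
  assumes "sm f" and "p \<in> S"
  shows "dz (\<lambda>q. f q / c) p = dz f p / c" and "dzb (\<lambda>q. f q / c) p = dzb f p / c"
  using wirtinger_mult[OF assms(1) smooth_const assms(2), of "1/c"] by (simp_all add: wirtinger_const)

lemma wirtinger_power:
  assumes "sm f" and "p \<in> S"
  shows "dz (\<lambda>q. f q ^ n) p = of_nat n * f p ^ (n - 1) * dz f p"
    and "dzb (\<lambda>q. f q ^ n) p = of_nat n * f p ^ (n - 1) * dzb f p"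
proof -
  have *: "dz (\<lambda>q. f q ^ n) p = of_nat n * f p ^ (n - 1) * dz f p \<and>
      dzb (\<lambda>q. f q ^ n) p = of_nat n * f p ^ (n - 1) * dzb f p"
  proof (induction n)
    case 0
    then show ?case by (simp add: wirtinger_const)
  next
    case (Suc n)
    then show ?case
      using wirtinger_mult[OF assms(1) smooth_power[OF assms(1)] assms(2), of n]
      by (cases n) (simp_all add: algebra_simps)
  qed
  show "dz (\<lambda>q. f q ^ n) p = of_nat n * f p ^ (n - 1) * dz f p"
    and "dzb (\<lambda>q. f q ^ n) p = of_nat n * f p ^ (n - 1) * dzb f p"
    using * by blast+
qed

lemma wirtinger_cnj:
  assumes "sm f" and "p \<in> S"
  shows "dz (\<lambda>q. cnj (f q)) p = cnj (dzb f p)" and "dzb (\<lambda>q. cnj (f q)) p = cnj (dz f p)"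
  by (simp_all add: d_z_def d_zbar_def flat_d_bounded_linear[OF bounded_linear_cnj assms])

text \<open>This is \<open>df = f\<^sub>z dz + f\<^sub>z\<^sub>b\<^sub>a\<^sub>r dzbar\<close>, evaluated on the tangent vector \<open>v\<close>.\<close>

lemma flat_d_wirtinger:
  assumes "sm f" and "p \<in> S"
  shows "dd f p v = v * dz f p + cnj v * dzb f p"
proof -
  have "v = Re v *\<^sub>R 1 + Im v *\<^sub>R \<i>"
    by (simp add: complex_eq_iff)
  then have "dd f p v = dd f p (Re v *\<^sub>R 1 + Im v *\<^sub>R \<i>)"
    by (rule arg_cong)
  also have "\<dots> = Re v *\<^sub>R dd f p 1 + Im v *\<^sub>R dd f p \<i>"
    using linear_flat_d[OF assms] by (simp only: linear_add linear_cmul)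
  also have "\<dots> = v * dz f p + cnj v * dzb f p"
    by (simp add: d_z_def d_zbar_def complex_eq_iff field_simps)
  finally show ?thesis .
qed

lemma flat_d_commute:
  fixes f :: "'a \<Rightarrow> complex"
  assumes "sm f" and "p \<in> S"
  shows "dd (\<lambda>q. dd f q v) p w = dd (\<lambda>q. dd f q w) p v"
proof -
  have "dd (\<lambda>q. dd f q v) p w =
      frechet_derivative (\<lambda>x. frechet_derivative (in_coord X z f) (at x) v) (at (z p)) w" for v w
    unfolding flat_d_def[of X z "\<lambda>q. dd f q v"] using assms(2)
    by (intro fun_cong[OF frechet_derivative_cong_open[OF open_image]])
       (auto simp: in_coord_at flat_d_def)
  moreover have "C_k_on 2 (z ` S) (in_coord X z f)"
    using assms(1) by (simp add: smooth_on_def C_infinity_on_def)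
  ultimately show ?thesis
    using second_derivative_symmetric[OF open_image _ imageI[OF assms(2)]] by simp
qed

lemma wirtinger_commute:
  assumes "sm f" and "p \<in> S"
  shows "dz (dzb f) p = dzb (dz f) p"
proof -
  have *: "sm (\<lambda>q. dd f q 1)" "sm (\<lambda>q. \<i> * dd f q \<i>)" "sm (\<lambda>q. dd f q \<i>)"
    "sm (\<lambda>q. dd f q 1 + \<i> * dd f q \<i>)" "sm (\<lambda>q. dd f q 1 - \<i> * dd f q \<i>)"
    by (intro smooth_intros smooth_flat_d assms)+
  have c: "dz (\<lambda>q. dd f q \<i>) p = (dd (\<lambda>q. dd f q 1) p \<i> - \<i> * dd (\<lambda>q. dd f q \<i>) p \<i>) / 2"
    "dzb (\<lambda>q. dd f q \<i>) p = (dd (\<lambda>q. dd f q 1) p \<i> + \<i> * dd (\<lambda>q. dd f q \<i>) p \<i>) / 2"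
    "dz (\<lambda>q. dd f q 1) p = (dd (\<lambda>q. dd f q 1) p 1 - \<i> * dd (\<lambda>q. dd f q 1) p \<i>) / 2"
    "dzb (\<lambda>q. dd f q 1) p = (dd (\<lambda>q. dd f q 1) p 1 + \<i> * dd (\<lambda>q. dd f q 1) p \<i>) / 2"
    using flat_d_commute[OF assms, of \<i> 1] by (simp_all add: d_z_def d_zbar_def)
  have "dz (\<lambda>q. (dd f q 1 + \<i> * dd f q \<i>) / 2) p = dzb (\<lambda>q. (dd f q 1 - \<i> * dd f q \<i>) / 2) p"
    using assms(2) *
    by (simp add: wirtinger_divide wirtinger_add wirtinger_diff wirtinger_mult smooth_const wirtinger_const c
        field_simps)
  then show ?thesis
    by (simp add: d_z_def[of X z f, abs_def] d_zbar_def[of X z f, abs_def])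
qed

lemma wirtinger_zero_imp_constant:
  assumes "sm f" and "\<And>p. p \<in> S \<Longrightarrow> dz f p = 0" and "\<And>p. p \<in> S \<Longrightarrow> dzb f p = 0"
  obtains C where "\<And>p. p \<in> S \<Longrightarrow> f p = C"
proof (cases "S = {}")
  case False
  then obtain p0 where p0: "p0 \<in> S" by blast
  have "(in_coord X z f has_derivative (\<lambda>h. 0)) (at x)" if "x \<in> z ` S" for x
  proof -
    from that obtain p where p: "p \<in> S" "x = z p" by blast
    have "dd f p = (\<lambda>h. 0)"
      using flat_d_wirtinger[OF assms(1) p(1)] assms(2,3) p(1) by auto
    with has_derivative_flat_d[OF assms(1) p(1)] p(2) show ?thesis by simp
  qed
  then have "f p = f p0" if "p \<in> S" for p
    using has_derivative_zero_unique_connected[OF open_image connected_image, of "in_coord X z f" "z p" "z p0"]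
      that p0 by (auto simp: in_coord_at)
  then show ?thesis using that by blast
qed (use that in auto)

end

section \<open>The complexified Lorentzian form\<close>

definition vcnj :: "complex ^ 5 \<Rightarrow> complex ^ 5" where
  "vcnj v = (\<chi> j. cnj (v $ j))"

lemma vcnj_component [simp]: "vcnj v $ j = cnj (v $ j)"
  by (simp add: vcnj_def)

lemma cvec_component [simp]: "cvec v $ j = complex_of_real (v $ j)"
  by (simp add: cvec_def)

lemma vcnj_simps [simp]:
  "vcnj (u + v) = vcnj u + vcnj v" "vcnj (u - v) = vcnj u - vcnj v" "vcnj (- u) = - vcnj u"
  "vcnj (a *s v) = cnj a *s vcnj v" "vcnj (vcnj v) = v" "vcnj (cvec w) = cvec w"
  by (simp_all add: vec_eq_iff)

lemma lor_commute: "lor u v = lor v u"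
  by (simp add: lor_def mult.commute)

lemma lor_linear [simp]:
  "lor (u + v) w = lor u w + lor v w" "lor w (u + v) = lor w u + lor w v"
  "lor (u - v) w = lor u w - lor v w" "lor w (u - v) = lor w u - lor w v"
  "lor (- u) w = - lor u w" "lor w (- u) = - lor w u"
  "lor (a *s u) w = a * lor u w" "lor w (a *s u) = a * lor w u"
  "lor 0 w = 0" "lor w 0 = 0"
  by (simp_all add: lor_def algebra_simps)

lemma lor_vcnj: "lor (vcnj u) (vcnj v) = cnj (lor u v)"
  by (simp add: lor_def)

lemma lor_cvec: "lor (cvec u) (cvec v) = complex_of_real (lor u v)"
  by (simp add: lor_def)

lemma cvec_simps [simp]:
  "cvec (u + v) = cvec u + cvec v" "cvec (r *\<^sub>R v) = complex_of_real r *s cvec v"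
  "cvec 0 = 0" "cvec u = cvec v \<longleftrightarrow> u = v" "cvec u = 0 \<longleftrightarrow> u = 0"
  by (auto simp: vec_eq_iff)

lemma UNIV_5: "(UNIV :: 5 set) = {1, 2, 3, 4, 5}"
  by (rule card_seteq[symmetric]) simp_all

lemma lor_nondegenerate:
  fixes v :: "complex ^ 5"
  assumes "\<And>w. lor v w = 0"
  shows "v = 0"
proof -
  have "lor v (axis j 1) = (if j = 5 then - v $ j else v $ j)" for j
  proof -
    have "j \<in> {1, 2, 3, 4, 5}" using UNIV_5 by blast
    then show ?thesis by (auto simp: lor_def axis_def)
  qed
  then have "v $ j = 0" for j
    using assms[of "axis j 1"] by (metis neg_equal_0_iff_equal)
  then show ?thesis by (simp add: vec_eq_iff)
qed

context coordinate_surface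
begin

abbreviation "vz \<equiv> vec_z X z"
abbreviation "vzb \<equiv> vec_zbar X z"

definition smooth_vec :: "('a \<Rightarrow> complex ^ 5) \<Rightarrow> bool" where
  "smooth_vec F \<longleftrightarrow> (\<forall>j. sm (\<lambda>q. F q $ j))"

lemma smooth_vec_component: "smooth_vec F \<Longrightarrow> sm (\<lambda>q. F q $ j)"
  by (simp add: smooth_vec_def)

lemma smooth_vec_derivative: "smooth_vec F \<Longrightarrow> smooth_vec (vz F)" "smooth_vec F \<Longrightarrow> smooth_vec (vzb F)"
  by (simp_all add: smooth_vec_def vec_z_def vec_zbar_def smooth_dz smooth_dzb)

lemma smooth_vec_add: "smooth_vec F \<Longrightarrow> smooth_vec G \<Longrightarrow> smooth_vec (\<lambda>q. F q + G q)"
  by (simp add: smooth_vec_def smooth_add)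

lemma smooth_vec_diff: "smooth_vec F \<Longrightarrow> smooth_vec G \<Longrightarrow> smooth_vec (\<lambda>q. F q - G q)"
  by (simp add: smooth_vec_def smooth_diff)

lemma smooth_vec_scale: "sm f \<Longrightarrow> smooth_vec F \<Longrightarrow> smooth_vec (\<lambda>q. f q *s F q)"
  by (simp add: smooth_vec_def smooth_mult)

lemma smooth_lor: "smooth_vec F \<Longrightarrow> smooth_vec G \<Longrightarrow> sm (\<lambda>q. lor (F q) (G q))"
  unfolding lor_def by (intro smooth_intros smooth_vec_component; assumption)

lemmas smooth_vec_intros =
  smooth_vec_derivative smooth_vec_add smooth_vec_diff smooth_vec_scale

lemma vec_wirtinger_cong:
  assumes "\<And>q. q \<in> S \<Longrightarrow> F q = G q" and "p \<in> S"
  shows "vz F p = vz G p" and "vzb F p = vzb G p"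
  using assms by (auto simp: vec_eq_iff vec_z_def vec_zbar_def intro: wirtinger_cong)

lemma vec_wirtinger_add:
  assumes "smooth_vec F" and "smooth_vec G" and "p \<in> S"
  shows "vz (\<lambda>q. F q + G q) p = vz F p + vz G p" and "vzb (\<lambda>q. F q + G q) p = vzb F p + vzb G p"
  using assms by (simp_all add: vec_eq_iff vec_z_def vec_zbar_def smooth_vec_def wirtinger_add)

lemma vec_wirtinger_diff:
  assumes "smooth_vec F" and "smooth_vec G" and "p \<in> S"
  shows "vz (\<lambda>q. F q - G q) p = vz F p - vz G p" and "vzb (\<lambda>q. F q - G q) p = vzb F p - vzb G p"
  using assms by (simp_all add: vec_eq_iff vec_z_def vec_zbar_def smooth_vec_def wirtinger_diff)

lemma vec_wirtinger_scale:
  assumes "sm f" and "smooth_vec F" and "p \<in> S"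
  shows "vz (\<lambda>q. f q *s F q) p = f p *s vz F p + dz f p *s F p"
    and "vzb (\<lambda>q. f q *s F q) p = f p *s vzb F p + dzb f p *s F p"
  using assms by (simp_all add: vec_eq_iff vec_z_def vec_zbar_def smooth_vec_def wirtinger_mult)

lemma vec_wirtinger_cnj:
  assumes "smooth_vec F" and "p \<in> S"
  shows "vz (\<lambda>q. vcnj (F q)) p = vcnj (vzb F p)" and "vzb (\<lambda>q. vcnj (F q)) p = vcnj (vz F p)"
  using assms by (simp_all add: vec_eq_iff vec_z_def vec_zbar_def smooth_vec_def wirtinger_cnj)

lemma vec_wirtinger_commute:
  assumes "smooth_vec F" and "p \<in> S"
  shows "vz (vzb F) p = vzb (vz F) p"
  using assms by (simp add: vec_eq_iff vec_z_def vec_zbar_def smooth_vec_def wirtinger_commute)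

lemma wirtinger_lor:
  assumes F: "smooth_vec F" and G: "smooth_vec G" and p: "p \<in> S"
  shows "dz (\<lambda>q. lor (F q) (G q)) p = lor (F p) (vz G p) + lor (vz F p) (G p)"
    and "dzb (\<lambda>q. lor (F q) (G q)) p = lor (F p) (vzb G p) + lor (vzb F p) (G p)"
proof -
  note c = smooth_vec_component[OF F] smooth_vec_component[OF G]
  note m = smooth_mult[OF c(1) c(2)]
  note a = smooth_add[OF m m] smooth_add[OF smooth_add[OF m m] m]
    smooth_add[OF smooth_add[OF smooth_add[OF m m] m] m]
  show "dz (\<lambda>q. lor (F q) (G q)) p = lor (F p) (vz G p) + lor (vz F p) (G p)"
    unfolding lor_def
    by (simp add: c m a p wirtinger_add wirtinger_diff wirtinger_mult vec_z_def)
  show "dzb (\<lambda>q. lor (F q) (G q)) p = lor (F p) (vzb G p) + lor (vzb F p) (G p)"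
    unfolding lor_def
    by (simp add: c m a p wirtinger_add wirtinger_diff wirtinger_mult vec_zbar_def)
qed

lemma wirtinger_real:
  assumes "sm f" and "\<And>q. q \<in> S \<Longrightarrow> cnj (f q) = f q" and "p \<in> S"
  shows "cnj (dz f p) = dzb f p" and "cnj (dzb f p) = dz f p"
  using wirtinger_cnj[OF assms(1,3)] wirtinger_cong[OF assms(2,3)] by simp_all

lemma vec_wirtinger_real:
  assumes "smooth_vec F" and "\<And>q. q \<in> S \<Longrightarrow> vcnj (F q) = F q" and "p \<in> S"
  shows "vcnj (vz F p) = vzb F p" and "vcnj (vzb F p) = vz F p"
  using vec_wirtinger_cnj[OF assms(1,3)] vec_wirtinger_cong[OF assms(2,3)] by simp_all

lemma laplacian_real:
  assumes "sm f" and "\<And>q. q \<in> S \<Longrightarrow> cnj (f q) = f q" and "p \<in> S"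
  shows "cnj (dzb (dz f) p) = dzb (dz f) p"
proof -
  have "cnj (dzb (dz f) p) = dz (\<lambda>q. cnj (dz f q)) p"
    by (simp add: wirtinger_cnj smooth_dz assms(1,3))
  also have "\<dots> = dz (dzb f) p"
    by (rule wirtinger_cong) (simp_all add: wirtinger_real assms)
  finally show ?thesis by (simp add: wirtinger_commute assms(1,3))
qed

lemma vec_laplacian_real:
  assumes "smooth_vec F" and "\<And>q. q \<in> S \<Longrightarrow> vcnj (F q) = F q" and "p \<in> S"
  shows "vcnj (vzb (vz F) p) = vzb (vz F) p"
proof -
  have "cnj (F q $ j) = F q $ j" if "q \<in> S" for q j
    using arg_cong[OF assms(2)[OF that], of "\<lambda>v. v $ j"] by simp
  then show ?thesis
    using laplacian_real[OF smooth_vec_component[OF assms(1)] _ assms(3)]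
    by (simp add: vec_eq_iff vec_z_def vec_zbar_def)
qed

lemma smooth_cvec:
  assumes "sm \<sigma>"
  shows "smooth_vec (\<lambda>q. cvec (\<sigma> q))"
proof -
  have "bounded_linear (\<lambda>v :: real ^ 5. complex_of_real (v $ j))" for j
    by (rule bounded_linear_compose[OF bounded_linear_of_real bounded_linear_vec_nth])
  from smooth_bounded_linear[OF this assms] show ?thesis
    by (simp add: smooth_vec_def)
qed

lemma cvec_flat_d:
  assumes "sm \<sigma>" and "p \<in> S"
  shows "cvec (dd \<sigma> p \<xi>) =
    \<xi> *s vz (\<lambda>q. cvec (\<sigma> q)) p + cnj \<xi> *s vzb (\<lambda>q. cvec (\<sigma> q)) p"
proof -
  have "bounded_linear (\<lambda>v :: real ^ 5. complex_of_real (v $ j))" for j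
    by (rule bounded_linear_compose[OF bounded_linear_of_real bounded_linear_vec_nth])
  from flat_d_bounded_linear[OF this assms]
  have "complex_of_real (dd \<sigma> p \<xi> $ j) = dd (\<lambda>q. cvec (\<sigma> q) $ j) p \<xi>" for j
    by simp
  then show ?thesis
    using flat_d_wirtinger[OF smooth_vec_component[OF smooth_cvec[OF assms(1)]] assms(2)]
    by (simp add: vec_eq_iff vec_z_def vec_zbar_def)
qed

text \<open>
  The calculus takes place in the complexification; this brings a conjugation-invariant section back
  to a smooth section of the real bundle.
\<close>

lemma real_section:
  assumes "smooth_vec F" and "\<And>q. q \<in> S \<Longrightarrow> vcnj (F q) = F q"
  obtains \<sigma> where "sm \<sigma>" and "\<And>q. q \<in> S \<Longrightarrow> cvec (\<sigma> q) = F q"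
proof
  let ?\<sigma> = "\<lambda>q. \<Sum>j\<in>UNIV. Re (F q $ j) *\<^sub>R (axis j 1 :: real ^ 5)"
  have "bounded_linear (\<lambda>x. Re x *\<^sub>R (axis j 1 :: real ^ 5))" for j
    by (intro bounded_linear_intros bounded_linear_Re)
  from smooth_bounded_linear[OF this smooth_vec_component[OF assms(1)]]
  show "sm ?\<sigma>"
    by (intro smooth_sum)
  show "cvec (?\<sigma> q) = F q" if "q \<in> S" for q
    using assms(2)[OF that]
    by (simp add: vec_eq_iff axis_def complex_eq_iff if_distrib[of "\<lambda>x. _ * x"] sum.delta' cong: if_cong)
qed

end

section \<open>The moving frame\<close>

text \<open>
  The lift, the normal and the Hopf coefficient are real, but they are given as complex-valued
  functions because \<open>\<partial>/\<partial>z\<close> acts on the complexification.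
\<close>

locale isothermic_frame = coordinate_surface X z
  for X :: "'a topology" and z :: "'a \<Rightarrow> complex" +
  fixes \<psi> N :: "'a \<Rightarrow> complex ^ 5" and c k :: "'a \<Rightarrow> complex"
  assumes smooth: "smooth_vec \<psi>" "smooth_vec N" "sm c" "sm k"
    and real: "vcnj (\<psi> q) = \<psi> q" "vcnj (N q) = N q" "cnj (k q) = k q"
    and null: "p \<in> S \<Longrightarrow> lor (\<psi> p) (\<psi> p) = 0"
    and conformal: "p \<in> S \<Longrightarrow> lor (vz \<psi> p) (vz \<psi> p) = 0"
      "p \<in> S \<Longrightarrow> lor (vz \<psi> p) (vzb \<psi> p) = 1 / 2"
    and normal: "p \<in> S \<Longrightarrow> lor (N p) (N p) = 1" "p \<in> S \<Longrightarrow> lor (N p) (\<psi> p) = 0"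
      "p \<in> S \<Longrightarrow> lor (N p) (vz \<psi> p) = 0" "p \<in> S \<Longrightarrow> lor (N p) (vzb (vz \<psi>) p) = 0"
    and hopf: "p \<in> S \<Longrightarrow> vz (vz \<psi>) p + (c p / 2) *s \<psi> p = k p *s N p"
begin

lemma lor_const_wirtinger:
  assumes "smooth_vec F" and "smooth_vec G" and "\<And>q. q \<in> S \<Longrightarrow> lor (F q) (G q) = C" and "p \<in> S"
  shows "lor (F p) (vz G p) = - lor (vz F p) (G p)" and "lor (F p) (vzb G p) = - lor (vzb F p) (G p)"
  using wirtinger_lor[OF assms(1,2,4)] wirtinger_cong[OF assms(3,4)]
  by (simp_all add: wirtinger_const eq_neg_iff_add_eq_0)

lemmas frame_smooth = smooth smooth_vec_derivative[OF smooth(1)]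
  smooth_vec_derivative[OF smooth(2)] smooth_vec_derivative[OF smooth_vec_derivative(1)[OF smooth(1)]]

context
  fixes p assumes p: "p \<in> S"
begin

lemma vz_vzb_psi: "vz (vzb \<psi>) p = vzb (vz \<psi>) p"
  by (rule vec_wirtinger_commute[OF smooth(1) p])

lemma conj_psi: "vcnj (vz \<psi> p) = vzb \<psi> p" "vcnj (vzb \<psi> p) = vz \<psi> p"
  using vec_wirtinger_real[OF smooth(1) real(1) p] by simp_all

lemma conj_N: "vcnj (vz N p) = vzb N p" "vcnj (vzb N p) = vz N p"
  using vec_wirtinger_real[OF smooth(2) real(2) p] by simp_all

lemma conj_k: "cnj (dz k p) = dzb k p" "cnj (dzb k p) = dz k p"
  using wirtinger_real[OF smooth(4) real(3) p] by simp_all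

lemma conformal_conj: "lor (vzb \<psi> p) (vzb \<psi> p) = 0"
  using lor_vcnj[of "vz \<psi> p" "vz \<psi> p"] conformal(1)[OF p] conj_psi by simp

lemma normal_conj: "lor (N p) (vzb \<psi> p) = 0"
  using lor_vcnj[of "N p" "vz \<psi> p"] normal(3)[OF p] conj_psi real(2) by simp

lemma psi_derivatives: "lor (\<psi> p) (vz \<psi> p) = 0" "lor (\<psi> p) (vzb \<psi> p) = 0"
  using lor_const_wirtinger[OF smooth(1) smooth(1) null p] lor_commute[of "\<psi> p"]
  by (simp_all add: eq_neg_iff_add_eq_0 flip: mult_2)

end

lemma conj_mixed: "p \<in> S \<Longrightarrow> vcnj (vzb (vz \<psi>) p) = vzb (vz \<psi>) p"
  by (rule vec_laplacian_real[OF smooth(1) real(1)])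

lemma mixed_products:
  assumes p: "p \<in> S"
  shows "lor (\<psi> p) (vzb (vz \<psi>) p) = - 1 / 2"
    and "lor (vz \<psi> p) (vzb (vz \<psi>) p) = 0"
    and "lor (vzb \<psi> p) (vzb (vz \<psi>) p) = 0"
proof -
  show "lor (\<psi> p) (vzb (vz \<psi>) p) = - 1 / 2"
    using lor_const_wirtinger(2)[OF frame_smooth(1) frame_smooth(5) psi_derivatives(1) p]
    conformal(2)[OF p] by (simp add: lor_commute)
  show *: "lor (vz \<psi> p) (vzb (vz \<psi>) p) = 0"
    using lor_const_wirtinger(2)[OF frame_smooth(5) frame_smooth(5) conformal(1) p]
    by (simp add: lor_commute[of "vzb (vz \<psi>) p"] eq_neg_iff_add_eq_0 flip: mult_2)
  show "lor (vzb \<psi> p) (vzb (vz \<psi>) p) = 0"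
    using lor_vcnj[of "vz \<psi> p" "vzb (vz \<psi>) p"] * conj_psi[OF p] conj_mixed[OF p] by simp
qed

lemmas gram_upper = null conformal normal conformal_conj normal_conj psi_derivatives mixed_products

lemma gram_lower:
  assumes p: "p \<in> S"
  shows "lor (vzb \<psi> p) (vz \<psi> p) = 1 / 2"
    and "lor (\<psi> p) (N p) = 0" "lor (vz \<psi> p) (N p) = 0" "lor (vzb (vz \<psi>) p) (N p) = 0"
    "lor (vzb \<psi> p) (N p) = 0" "lor (vz \<psi> p) (\<psi> p) = 0" "lor (vzb \<psi> p) (\<psi> p) = 0"
    "lor (vzb (vz \<psi>) p) (\<psi> p) = - 1 / 2" "lor (vzb (vz \<psi>) p) (vz \<psi> p) = 0"
    "lor (vzb (vz \<psi>) p) (vzb \<psi> p) = 0"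
  using gram_upper[OF p] lor_commute by metis+

lemmas gram = gram_upper gram_lower

text \<open>
  The Gram matrix is triangular enough to read off the coefficients of a combination from its
  products with the frame, whatever the square of the mixed derivative is; hence the
  frame is independent, and five independent vectors span.
\<close>

lemma frame_spans:
  assumes p: "p \<in> S"
  shows "\<exists>a0 a1 a2 a3 a4. v = a0 *s \<psi> p + a1 *s vz \<psi> p + a2 *s vzb \<psi> p + a3 *s vzb (vz \<psi>) p + a4 *s N p"
proof -
  define L :: "complex ^ 5 \<Rightarrow> complex ^ 5" where
    "L a = a $ 1 *s \<psi> p + a $ 2 *s vz \<psi> p + a $ 3 *s vzb \<psi> p + a $ 4 *s vzb (vz \<psi>) p + a $ 5 *s N p" for a
  have lin: "Vector_Spaces.linear (*s) (*s) L"
    by (simp add: Vector_Spaces.linear_iff L_def vec_eq_iff algebra_simps vec.vector_space_axioms)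
  \<comment> \<open>Products with \<open>\<psi>\<close>, \<open>\<psi>\<^sub>z\<close>, \<open>\<psi>\<^sub>z\<^sub>b\<^sub>a\<^sub>r\<close> and \<open>N\<close> give the last four coefficients, up to order, and then the first is left.\<close>
  have "inj L"
  proof (rule injI)
    fix x y assume "L x = L y"
    then have e: "lor (L x) w = lor (L y) w" for w by simp
    have "x $ 4 = y $ 4" and "x $ 3 = y $ 3" and "x $ 2 = y $ 2" and "x $ 5 = y $ 5"
      using e[of "\<psi> p"] e[of "vz \<psi> p"] e[of "vzb \<psi> p"] e[of "N p"] 
      by (simp_all add: L_def gram p)
    moreover from this have "x $ 1 = y $ 1"
      using e[of "vzb (vz \<psi>) p"] by (simp add: L_def gram p)
    ultimately have "\<forall>j\<in>{1, 2, 3, 4, 5}. x $ j = y $ j"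
      by simp
    then show "x = y" unfolding UNIV_5[symmetric] vec_eq_iff by simp
  qed
  then have "surj L"
    by (rule vec.linear_inj_imp_surj[OF lin])
  then obtain a where "v = L a" by (metis surjD)
  then show ?thesis unfolding L_def by blast
qed

lemma frame_eqI:
  assumes p: "p \<in> S" and "lor u (\<psi> p) = lor w (\<psi> p)" and "lor u (vz \<psi> p) = lor w (vz \<psi> p)"
    and "lor u (vzb \<psi> p) = lor w (vzb \<psi> p)" and "lor u (vzb (vz \<psi>) p) = lor w (vzb (vz \<psi>) p)"
    and "lor u (N p) = lor w (N p)"
  shows "u = w"
proof -
  have "lor (u - w) v = 0" for v
  proof -
    obtain a0 a1 a2 a3 a4 where "v = a0 *s \<psi> p + a1 *s vz \<psi> p + a2 *s vzb \<psi> p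
        + a3 *s vzb (vz \<psi>) p + a4 *s N p"
      using frame_spans[OF p] by blast
    then show ?thesis using assms by simp
  qed
  then show ?thesis using lor_nondegenerate[of "u - w"] by simp
qed

lemma vz_vz_psi: "p \<in> S \<Longrightarrow> vz (vz \<psi>) p = k p *s N p - (c p / 2) *s \<psi> p"
  using hopf[of p] by (simp add: eq_diff_eq)

text \<open>
  The mixed derivatives commute, so this is the conjugate derivative of the Hopf
  equation. It still contains the derivatives of \<open>N\<close> and \<open>c\<close>, which are eliminated below.
\<close>

lemma vz_mixed:
  assumes p: "p \<in> S"
  shows "vz (vzb (vz \<psi>)) p
    = dzb k p *s N p + k p *s vzb N p - (dzb c p / 2) *s \<psi> p - (c p / 2) *s vzb \<psi> p"
proof -
  have "vz (vzb (vz \<psi>)) p = vzb (vz (vz \<psi>)) p"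
    by (rule vec_wirtinger_commute[OF frame_smooth(5) p])
  also have "\<dots> = vzb (\<lambda>q. k q *s N q - (c q / 2) *s \<psi> q) p"
    by (rule vec_wirtinger_cong[OF vz_vz_psi p])
  also have "\<dots> = dzb k p *s N p + k p *s vzb N p - (dzb c p / 2) *s \<psi> p - (c p / 2) *s vzb \<psi> p"
    by (simp add: vec_wirtinger_diff vec_wirtinger_scale smooth_vec_scale smooth_divide
        wirtinger_divide frame_smooth p)
  finally show ?thesis .
qed

lemma normal_derivative_tangential:
  assumes p: "p \<in> S"
  shows "lor (N p) (vz N p) = 0" "lor (N p) (vzb N p) = 0" 
proof -
  have "lor (N p) (vz N p) = - lor (N p) (vz N p)" "lor (N p) (vzb N p) = - lor (N p) (vzb N p)"
    using lor_const_wirtinger[OF frame_smooth(2) frame_smooth(2) normal(1) p]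
    by (simp_all add: lor_commute[of _ "N p"])
  then show "lor (N p) (vz N p) = 0" "lor (N p) (vzb N p) = 0"
    by (simp_all add: eq_neg_iff_add_eq_0 flip: mult_2)
qed

text \<open>
  The Weingarten equation: \<open>N\<close> is orthogonal to the rest of the frame, so the products of \<open>N\<^sub>z\<close> with
  the frame are minus the normal components of the derivatives of the frame.
\<close>

lemma vz_N:
  assumes p: "p \<in> S"
  shows "vz N p = (2 * dzb k p) *s \<psi> p - (2 * k p) *s vzb \<psi> p"
proof (rule frame_eqI[OF p])
  have e: "lor (vz N p) (F p) = - lor (N p) (vz F p)"
    if "smooth_vec F" "\<And>q. q \<in> S \<Longrightarrow> lor (N q) (F q) = 0" for F
    using lor_const_wirtinger(1)[OF frame_smooth(2) that p] by simp
  note n = normal_derivative_tangential[OF p]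
  show "lor (vz N p) (\<psi> p) = lor ((2 * dzb k p) *s \<psi> p - (2 * k p) *s vzb \<psi> p) (\<psi> p)"
    by (subst e) (simp_all add: frame_smooth gram p)
  show "lor (vz N p) (vz \<psi> p) = lor ((2 * dzb k p) *s \<psi> p - (2 * k p) *s vzb \<psi> p) (vz \<psi> p)"
    by (subst e) (simp_all add: frame_smooth gram p vz_vz_psi)
  show "lor (vz N p) (vzb \<psi> p) = lor ((2 * dzb k p) *s \<psi> p - (2 * k p) *s vzb \<psi> p) (vzb \<psi> p)"
    by (subst e) (simp_all add: frame_smooth gram p vz_vzb_psi)
  show "lor (vz N p) (vzb (vz \<psi>) p) =
      lor ((2 * dzb k p) *s \<psi> p - (2 * k p) *s vzb \<psi> p) (vzb (vz \<psi>) p)"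
    by (subst e) (simp_all add: frame_smooth gram p vz_mixed n)
  show "lor (vz N p) (N p) = lor ((2 * dzb k p) *s \<psi> p - (2 * k p) *s vzb \<psi> p) (N p)"
    by (simp add: lor_commute[of _ "N p"] n gram p)
qed

lemma vzb_N:
  assumes p: "p \<in> S"
  shows "vzb N p = (2 * dz k p) *s \<psi> p - (2 * k p) *s vz \<psi> p"
  using arg_cong[OF vz_N[OF p], of vcnj] by (simp add: conj_N conj_psi conj_k real p)

text \<open>
  The mixed derivative is orthogonal to \<open>\<psi>\<^sub>z\<close>; differentiating that relation by \<open>zbar\<close> expresses its
  square by a third derivative of \<open>\<psi>\<close>, whose product with \<open>\<psi>\<^sub>z\<close> comes from the Weingarten equation.
\<close>

lemma mixed_square:
  assumes p: "p \<in> S"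
  shows "lor (vzb (vz \<psi>) p) (vzb (vz \<psi>) p) = (k p)\<^sup>2"
proof -
  have "vcnj (vz (vzb (vz \<psi>)) p) = vzb (vzb (vz \<psi>)) p"
    using vec_wirtinger_cnj(2)[OF frame_smooth(10) p] vec_wirtinger_cong(2)[OF conj_mixed p] by simp
  from this[symmetric] have "vzb (vzb (vz \<psi>)) p
      = dz k p *s N p + k p *s vz N p - (cnj (dzb c p) / 2) *s \<psi> p - (cnj (c p) / 2) *s vz \<psi> p"
    by (simp add: vz_mixed p conj_N conj_psi conj_k real)
  then have "lor (vz \<psi> p) (vzb (vzb (vz \<psi>)) p) = - (k p)\<^sup>2"
    by (simp add: vz_N gram p power2_eq_square)
  then show ?thesis
    using lor_const_wirtinger(2)[OF frame_smooth(5) frame_smooth(10) mixed_products(2) p] by simp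
qed

text \<open>
  The Gauss equation, obtained by computing the \<open>z\<close>-derivative of the square of the mixed derivative
  of \<open>\<psi>\<close> in two ways.
\<close>

lemma gauss:
  assumes p: "p \<in> S"
  shows "dzb c p = 8 * k p * dz k p"
proof -
  have "dz (\<lambda>q. lor (vzb (vz \<psi>) q) (vzb (vz \<psi>) q)) p = dz (\<lambda>q. (k q)\<^sup>2) p"
    by (rule wirtinger_cong[OF mixed_square p])
  then have "2 * lor (vzb (vz \<psi>) p) (vz (vzb (vz \<psi>)) p) = 2 * k p * dz k p"
    by (simp add: wirtinger_lor wirtinger_power frame_smooth p lor_commute[of "vz _ p"])
  then show ?thesis
    by (simp add: vz_mixed vzb_N gram p field_simps)
qed

lemma vz_mixed':
  assumes p: "p \<in> S"
  shows "vz (vzb (vz \<psi>)) p = dzb k p *s N p - (2 * k p * dz k p) *s \<psi> p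
    - (2 * (k p)\<^sup>2) *s vz \<psi> p - (c p / 2) *s vzb \<psi> p"
  unfolding vz_mixed[OF p] vzb_N[OF p] gauss[OF p]
  by (simp add: vec_eq_iff algebra_simps power2_eq_square)

text \<open>
  The Codazzi equation: the coefficients of \<open>\<psi>\<close> in the two expressions for the mixed second derivative
  of \<open>N\<close> are conjugate to each other. Pairing with the mixed derivative of \<open>\<psi>\<close> isolates them.
\<close>

lemma codazzi:
  assumes p: "p \<in> S"
  shows "cnj (2 * dz (dz k) p + c p * k p) = 2 * dz (dz k) p + c p * k p"
proof -
  have "vzb (vz N) p = vzb (\<lambda>q. (2 * dzb k q) *s \<psi> q - (2 * k q) *s vzb \<psi> q) p"
    by (rule vec_wirtinger_cong[OF vz_N p])
  also have "\<dots> = (2 * dzb (dzb k) p) *s \<psi> p - (2 * k p) *s vzb (vzb \<psi>) p"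
    by (simp add: vec_wirtinger_diff vec_wirtinger_scale smooth_vec_scale smooth_mult smooth_const
        smooth_dzb wirtinger_mult wirtinger_const frame_smooth p)
  finally have 1: "vzb (vz N) p = (2 * dzb (dzb k) p) *s \<psi> p - (2 * k p) *s vzb (vzb \<psi>) p" .
  have "vz (vzb N) p = vz (\<lambda>q. (2 * dz k q) *s \<psi> q - (2 * k q) *s vz \<psi> q) p"
    by (rule vec_wirtinger_cong[OF vzb_N p])
  also have "\<dots> = (2 * dz (dz k) p) *s \<psi> p - (2 * k p) *s vz (vz \<psi>) p"
    by (simp add: vec_wirtinger_diff vec_wirtinger_scale smooth_vec_scale smooth_mult smooth_const
        smooth_dz wirtinger_mult wirtinger_const frame_smooth p)
  finally have 2: "vz (vzb N) p = (2 * dz (dz k) p) *s \<psi> p - (2 * k p) *s vz (vz \<psi>) p" .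
  have cc: "vzb (vzb \<psi>) p = vcnj (vz (vz \<psi>) p)"
    using vec_wirtinger_cnj(2)[OF frame_smooth(5) p] vec_wirtinger_cong(2)[OF conj_psi(1) p] by simp
  have kk: "dzb (dzb k) p = cnj (dz (dz k) p)"
    using wirtinger_cnj(2)[OF smooth_dz[OF smooth(4)] p] wirtinger_cong(2)[OF conj_k(1) p] by simp
  have "lor (vzb (vz \<psi>) p) (vzb (vz N) p) = lor (vzb (vz \<psi>) p) (vz (vzb N) p)"
    by (simp add: vec_wirtinger_commute frame_smooth p)
  then have "2 * cnj (2 * dz (dz k) p + c p * k p) = 2 * (2 * dz (dz k) p + c p * k p)"
    by (simp add: 1 2 cc kk vz_vz_psi gram p real field_simps)
  then show ?thesis by (rule mult_left_cancel[THEN iffD1, rotated]) simp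
qed

end

section \<open>Polynomial conserved quantities\<close>

context isothermic_frame
begin

text \<open>
  The image of \<open>k\<close> under the operator \<open>2 \<partial>\<^sub>z\<^sup>2 + c\<close> that links the rungs of the ladder. The Codazzi
  equation asserts that it is real.
\<close>

definition \<delta> :: "'a \<Rightarrow> complex" where
  "\<delta> q = 2 * dz (dz k) q + c q * k q"

text \<open>
  The explicit primitive, in the \<open>z\<close>-direction, of \<open>k \<delta>\<^sub>z\<^sub>b\<^sub>a\<^sub>r - \<delta> k\<^sub>z\<^sub>b\<^sub>a\<^sub>r\<close>: see \<open>dz_\<mu>\<close>. It accounts
  for the terms of the equation that are cubic and of fifth degree in \<open>k\<close>.
\<close>

definition \<mu> :: "'a \<Rightarrow> complex" where
  "\<mu> q = 2 * (dzb (dz k) q * k q + k q ^ 4 - dz k q * dzb k q)"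

lemma smooth_\<delta>: "sm \<delta>"
  unfolding \<delta>_def[abs_def] by (intro smooth_intros smooth)

lemma smooth_\<mu>: "sm \<mu>"
  unfolding \<mu>_def[abs_def] by (intro smooth_intros smooth)

lemma \<delta>_real: "p \<in> S \<Longrightarrow> cnj (\<delta> p) = \<delta> p"
  using codazzi[of p] unfolding \<delta>_def .

lemma \<mu>_real: "p \<in> S \<Longrightarrow> cnj (\<mu> p) = \<mu> p"
  unfolding \<mu>_def by (simp add: laplacian_real smooth real conj_k)

lemma dzb_\<delta>:
  assumes p: "p \<in> S"
  shows "dzb \<delta> p = 2 * dzb (dz (dz k)) p + c p * dzb k p + 8 * (k p)\<^sup>2 * dz k p"
proof -
  have "dzb \<delta> p = 2 * dzb (dz (dz k)) p + c p * dzb k p + dzb c p * k p"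
    unfolding \<delta>_def[abs_def]
    by (simp add: wirtinger_add wirtinger_mult wirtinger_const smooth_intros smooth p)
  then show ?thesis by (simp add: gauss p power2_eq_square)
qed

text \<open>
  The Gauss equation enters through \<open>\<delta>\<^sub>z\<^sub>b\<^sub>a\<^sub>r\<close>: its cubic term \<open>8 k\<^sup>2 k\<^sub>z\<close> is what the summand \<open>k\<^sup>4\<close> of \<open>\<mu>\<close>
  produces.
\<close>

lemma dz_\<mu>:
  assumes p: "p \<in> S"
  shows "dz \<mu> p = k p * dzb \<delta> p - \<delta> p * dzb k p"
proof -
  have "dz \<mu> p = 2 * (dz (dzb (dz k)) p * k p + dzb (dz k) p * dz k p + 4 * k p ^ 3 * dz k p
      - dz (dz k) p * dzb k p - dz k p * dz (dzb k) p)"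
    unfolding \<mu>_def[abs_def]
    by (simp add: wirtinger_add wirtinger_diff wirtinger_power wirtinger_mult wirtinger_const smooth_intros
        smooth p algebra_simps)
  also have "dz (dzb (dz k)) p = dzb (dz (dz k)) p"
    by (rule wirtinger_commute[OF smooth_dz[OF smooth(4)] p])
  also have "dz (dzb k) p = dzb (dz k) p"
    by (rule wirtinger_commute[OF smooth(4) p])
  finally show ?thesis
    by (simp add: dzb_\<delta> p \<delta>_def algebra_simps power2_eq_square power3_eq_cube)
qed

lemma real_constant:
  assumes "sm f" and "\<And>p. p \<in> S \<Longrightarrow> cnj (f p) = f p" and "\<And>p. p \<in> S \<Longrightarrow> dz f p = 0"
  obtains C :: real where "\<And>p. p \<in> S \<Longrightarrow> f p = complex_of_real C"
proof -
  have "dzb f p = 0" if "p \<in> S" for p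
    using wirtinger_real(1)[OF assms(1,2) that] assms(3)[OF that] by simp
  with assms(1,3) obtain C where C: "\<And>p. p \<in> S \<Longrightarrow> f p = C"
    using wirtinger_zero_imp_constant by blast
  then have "f p = complex_of_real (Re C)" if "p \<in> S" for p
    using that assms(2)[OF that] by (simp add: complex_eq_iff)
  then show ?thesis using that by blast
qed

text \<open>
  The \<open>dz\<close>-part of \<open>dQ = - \<eta> P\<close>. For real \<open>P\<close> and \<open>Q\<close> the other part is its conjugate; see
  \<open>parallel_iff_ladder\<close>.
\<close>

definition ladder :: "('a \<Rightarrow> complex ^ 5) \<Rightarrow> ('a \<Rightarrow> complex ^ 5) \<Rightarrow> bool" where
  "ladder P Q \<longleftrightarrow>
    (\<forall>p\<in>S. vz Q p = lor (\<psi> p) (P p) *s vzb \<psi> p - lor (vzb \<psi> p) (P p) *s \<psi> p)"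

text \<open>
  The derivative of \<open>F\<close> lies in the span of \<open>\<psi>\<close> and one of its first derivatives, hence it is orthogonal to
  \<open>\<psi>\<close> and \<open>N\<close>. So derivatives of products of \<open>F\<close> with the frame mostly fall on the frame,
  where the structure equations apply.
\<close>

lemma ladder_scalars:
  assumes F: "smooth_vec F" "\<And>q. q \<in> S \<Longrightarrow> vcnj (F q) = F q" and "ladder P F" and p: "p \<in> S"
  shows "dz (\<lambda>q. lor (F q) (\<psi> q)) p = lor (F p) (vz \<psi> p)"
    and "dzb (\<lambda>q. lor (F q) (\<psi> q)) p = lor (F p) (vzb \<psi> p)"
    and "dz (\<lambda>q. lor (F q) (N q)) p =
      2 * lor (F p) (\<psi> p) * dzb k p - 2 * k p * dzb (\<lambda>q. lor (F q) (\<psi> q)) p"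
    and "2 * dz (dz (\<lambda>q. lor (F q) (\<psi> q))) p + c p * lor (F p) (\<psi> p) - 2 * lor (F p) (N p) * k p
      = lor (\<psi> p) (P p)"
    and "dzb (dz (\<lambda>q. lor (F q) (\<psi> q))) p = lor (F p) (vzb (vz \<psi>) p)"
proof -
  have F1: "vz F p = lor (\<psi> p) (P p) *s vzb \<psi> p - lor (vzb \<psi> p) (P p) *s \<psi> p" if "p \<in> S" for p
    using assms(3) that by (simp add: ladder_def)
  have F2: "vzb F p = cnj (lor (\<psi> p) (P p)) *s vz \<psi> p - cnj (lor (vzb \<psi> p) (P p)) *s \<psi> p"
    if "p \<in> S" for p
    using vec_wirtinger_real(1)[OF F that] F1[OF that] real conj_psi[OF that] by simp
  have d1: "dz (\<lambda>q. lor (F q) (\<psi> q)) p = lor (F p) (vz \<psi> p)" if "p \<in> S" for p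
    using that by (simp add: wirtinger_lor F frame_smooth F1 gram)
  then show "dz (\<lambda>q. lor (F q) (\<psi> q)) p = lor (F p) (vz \<psi> p)"
    using p .
  show d2: "dzb (\<lambda>q. lor (F q) (\<psi> q)) p = lor (F p) (vzb \<psi> p)"
    using p by (simp add: wirtinger_lor F frame_smooth F2 gram)
  show "dz (\<lambda>q. lor (F q) (N q)) p =
      2 * lor (F p) (\<psi> p) * dzb k p - 2 * k p * dzb (\<lambda>q. lor (F q) (\<psi> q)) p"
    using p by (simp add: d2 wirtinger_lor F frame_smooth F1 gram vz_N)
  have "dz (dz (\<lambda>q. lor (F q) (\<psi> q))) p = dz (\<lambda>q. lor (F q) (vz \<psi> q)) p"
    by (rule wirtinger_cong[OF d1 p])
  then show "2 * dz (dz (\<lambda>q. lor (F q) (\<psi> q))) p + c p * lor (F p) (\<psi> p) - 2 * lor (F p) (N p) * k p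
      = lor (\<psi> p) (P p)"
    using p by (simp add: wirtinger_lor F frame_smooth F1 gram vz_vz_psi field_simps)
  have "dzb (dz (\<lambda>q. lor (F q) (\<psi> q))) p = dzb (\<lambda>q. lor (F q) (vz \<psi> q)) p"
    by (rule wirtinger_cong[OF d1 p])
  then show "dzb (dz (\<lambda>q. lor (F q) (\<psi> q))) p = lor (F p) (vzb (vz \<psi>) p)"
    using p by (simp add: wirtinger_lor F frame_smooth F2 gram)
qed

lemma ladder_annihilates:
  assumes "ladder P (\<lambda>q. 0)" and p: "p \<in> S"
  shows "lor (\<psi> p) (P p) = 0" 
proof -
  have "vz (\<lambda>q. 0) p = 0"
    by (simp add: vec_z_def vec_eq_iff wirtinger_const)
  then have e: "lor (\<psi> p) (P p) *s vzb \<psi> p - lor (vzb \<psi> p) (P p) *s \<psi> p = 0"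
    using assms by (simp add: ladder_def)
  have "lor (lor (\<psi> p) (P p) *s vzb \<psi> p - lor (vzb \<psi> p) (P p) *s \<psi> p) (vz \<psi> p) = 0"
    unfolding e by simp
  then show ?thesis by (simp add: gram p)
qed

text \<open>
  The descent from \<open>P2\<close> to \<open>P0\<close>: each rung determines the product with \<open>\<psi>\<close> of the next section, and
  the product with \<open>N\<close> up to a constant. The two constants that arise after \<open>g\<close>, divided by \<open>g\<close>, are \<open>s1\<close> and \<open>s2\<close>.
\<close>

lemma equation_of_ladder:
  assumes smooth_P: "smooth_vec P0" "smooth_vec P1" "smooth_vec P2"
    and real_P: "\<And>q. vcnj (P0 q) = P0 q" "\<And>q. vcnj (P1 q) = P1 q" "\<And>q. vcnj (P2 q) = P2 q"
    and lad: "ladder (\<lambda>q. 0) P0" "ladder P0 P1" "ladder P1 P2" "ladder P2 (\<lambda>q. 0)"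
    and nonzero: "p0 \<in> S" "P2 p0 \<noteq> 0"
  obtains s1 s2 :: real where "\<And>p. p \<in> S \<Longrightarrow>
    2 * dz (dz \<delta>) p + c p * \<delta> p + 4 * \<mu> p * k p + complex_of_real s1 * \<delta> p + complex_of_real s2 * k p = 0"
proof -
  have realN: "cnj (lor (P q) (N q)) = lor (P q) (N q)" if "\<And>q. vcnj (P q) = P q" for P q
    using lor_vcnj[of "P q" "N q"] that real(2) by simp
  note sc0 = ladder_scalars[OF smooth_P(1) real_P(1) lad(1)]
  note sc1 = ladder_scalars[OF smooth_P(2) real_P(2) lad(2)]
  note sc2 = ladder_scalars[OF smooth_P(3) real_P(3) lad(3)]
  note sl = smooth_lor[OF smooth_P(1)] smooth_lor[OF smooth_P(2)] smooth_lor[OF smooth_P(3)]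
  \<comment> \<open>The top rung: \<open>f2 = 0\<close>, hence \<open>m2\<close> is a constant \<open>g\<close>.\<close>
  have f2: "lor (P2 q) (\<psi> q) = 0" if "q \<in> S" for q
    using ladder_annihilates[OF lad(4) that] by (simp add: lor_commute)
  have df2: "dz (\<lambda>q. lor (P2 q) (\<psi> q)) q = 0" "dzb (\<lambda>q. lor (P2 q) (\<psi> q)) q = 0" if "q \<in> S" for q
    using wirtinger_cong[OF f2 that] by (simp_all add: wirtinger_const)
  have ddf2: "dz (dz (\<lambda>q. lor (P2 q) (\<psi> q))) q = 0" "dzb (dz (\<lambda>q. lor (P2 q) (\<psi> q))) q = 0" if "q \<in> S" for q
    using wirtinger_cong[OF df2(1) that] by (simp_all add: wirtinger_const)
  have "dz (\<lambda>q. lor (P2 q) (N q)) p = 0" if "p \<in> S" for p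
    using sc2(3)[OF that] f2[OF that] df2[OF that] by simp
  then obtain g where g: "\<And>p. p \<in> S \<Longrightarrow> lor (P2 p) (N p) = complex_of_real g"
    using real_constant[of "\<lambda>q. lor (P2 q) (N q)", OF sl(3)[OF smooth(2)] realN[of P2, OF real_P(3)]] by blast
  have "g \<noteq> 0"
  proof
    assume "g = 0"
    have "P2 p0 = 0"
      by (rule frame_eqI[OF nonzero(1)])
         (use g[OF nonzero(1)] f2[OF nonzero(1)] df2[OF nonzero(1)] ddf2[OF nonzero(1)]
            sc2(1,2,5)[OF nonzero(1)] \<open>g = 0\<close> in simp_all)
    then show False using nonzero(2) by simp
  qed
  \<comment> \<open>The rung of \<open>P2\<close>, with \<open>f2 = 0\<close>, reads \<open>- 2 g k = f1\<close>.\<close>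
  have f1: "lor (P1 q) (\<psi> q) = - 2 * g * k q" if "q \<in> S" for q
    using sc2(4)[OF that] f2[OF that] ddf2[OF that] g[OF that] lor_commute[of "P1 q"] by simp
  have df1: "dz (\<lambda>q. lor (P1 q) (\<psi> q)) q = - 2 * g * dz k q"
    "dzb (\<lambda>q. lor (P1 q) (\<psi> q)) q = - 2 * g * dzb k q" if "q \<in> S" for q
    using wirtinger_cong[OF f1 that] that
    by (simp_all add: wirtinger_mult wirtinger_minus smooth_minus wirtinger_const smooth_mult smooth_const smooth)
  have ddf1: "dz (dz (\<lambda>q. lor (P1 q) (\<psi> q))) q = - 2 * g * dz (dz k) q" if "q \<in> S" for q
    using wirtinger_cong(1)[OF df1(1) that] that
    by (simp add: wirtinger_mult wirtinger_minus smooth_minus wirtinger_const smooth_mult smooth_const smooth smooth_dz)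
  have "dz (\<lambda>q. lor (P1 q) (N q)) p = 0" if "p \<in> S" for p
    using sc1(3)[OF that] f1[OF that] df1[OF that] by simp
  then obtain n where n: "\<And>p. p \<in> S \<Longrightarrow> lor (P1 p) (N p) = complex_of_real n"
    using real_constant[of "\<lambda>q. lor (P1 q) (N q)", OF sl(2)[OF smooth(2)] realN[of P1, OF real_P(2)]] by blast
  \<comment> \<open>The rung of \<open>P1\<close> gives \<open>f0\<close>; then \<open>m0 - 4 g \<mu>\<close> is a constant by the choice of \<open>\<mu>\<close>.\<close>
  have f0: "lor (P0 q) (\<psi> q) = - 2 * g * \<delta> q - 2 * n * k q" if "q \<in> S" for q
    using sc1(4)[OF that] f1[OF that] ddf1[OF that] n[OF that] lor_commute[of "P0 q"]
    by (simp add: \<delta>_def algebra_simps)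
  have df0: "dz (\<lambda>q. lor (P0 q) (\<psi> q)) q = - 2 * g * dz \<delta> q - 2 * n * dz k q"
    "dzb (\<lambda>q. lor (P0 q) (\<psi> q)) q = - 2 * g * dzb \<delta> q - 2 * n * dzb k q" if "q \<in> S" for q
    using wirtinger_cong[OF f0 that] that
    by (simp_all add: wirtinger_diff wirtinger_mult wirtinger_minus smooth_minus wirtinger_const smooth_mult smooth_const smooth smooth_\<delta> smooth_mult)
  have ddf0: "dz (dz (\<lambda>q. lor (P0 q) (\<psi> q))) q = - 2 * g * dz (dz \<delta>) q - 2 * n * dz (dz k) q"
    if "q \<in> S" for q
    using wirtinger_cong(1)[OF df0(1) that] that
    by (simp add: wirtinger_diff wirtinger_mult wirtinger_minus smooth_minus wirtinger_const smooth_mult smooth_const smooth smooth_\<delta> smooth_mult smooth_dz)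
  have "dz (\<lambda>q. lor (P0 q) (N q) - 4 * g * \<mu> q) p = 0" if "p \<in> S" for p
    using that
    by (simp add: sc0(3) f0 df0 dz_\<mu> wirtinger_diff wirtinger_mult wirtinger_minus smooth_minus wirtinger_const smooth_mult smooth_const smooth smooth_\<mu> smooth_mult sl
        algebra_simps)
  moreover have "sm (\<lambda>q. lor (P0 q) (N q) - 4 * g * \<mu> q)"
    by (intro smooth_intros sl smooth smooth_\<mu>)
  moreover have "cnj (lor (P0 q) (N q) - 4 * g * \<mu> q) = lor (P0 q) (N q) - 4 * g * \<mu> q" if "q \<in> S" for q
    using realN[of P0, OF real_P(1)] \<mu>_real[OF that] by simp
  ultimately obtain m where m: "\<And>p. p \<in> S \<Longrightarrow> lor (P0 p) (N p) - 4 * g * \<mu> p = complex_of_real m"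
    using real_constant[of "\<lambda>q. lor (P0 q) (N q) - 4 * g * \<mu> q"] by blast
  show ?thesis
  proof (rule that[of "n / g" "m / g"])
    fix p assume p: "p \<in> S"
    \<comment> \<open>The rung of \<open>P0\<close> is the equation, up to the factor \<open>- 2 g\<close>.\<close>
    have "lor (P0 p) (N p) = 4 * g * \<mu> p + m"
      using m[OF p] by (simp add: algebra_simps)
    then have "2 * dz (dz (\<lambda>q. lor (P0 q) (\<psi> q))) p + c p * lor (P0 p) (\<psi> p)
        - 2 * (4 * g * \<mu> p + m) * k p = 0"
      using sc0(4)[OF p] by simp
    then have "- 2 * (g * (2 * dz (dz \<delta>) p + c p * \<delta> p + 4 * \<mu> p * k p) + n * \<delta> p + m * k p) = 0"
      unfolding f0[OF p] ddf0[OF p] \<delta>_def[of p] by (simp add: algebra_simps)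
    then have "g * (2 * dz (dz \<delta>) p + c p * \<delta> p + 4 * \<mu> p * k p) + n * \<delta> p + m * k p = 0"
      unfolding mult_eq_0_iff by simp
    then show "2 * dz (dz \<delta>) p + c p * \<delta> p + 4 * \<mu> p * k p + complex_of_real (n / g) * \<delta> p
        + complex_of_real (m / g) * k p = 0"
      using \<open>g \<noteq> 0\<close> by (simp add: field_simps)
  qed
qed

text \<open>
  The section whose products with \<open>\<psi>\<close>, \<open>\<psi>\<^sub>z\<close>, \<open>\<psi>\<^sub>z\<^sub>b\<^sub>a\<^sub>r\<close> and \<open>N\<close> are \<open>f\<close>, \<open>f\<^sub>z\<close>, \<open>f\<^sub>z\<^sub>b\<^sub>a\<^sub>r\<close> and \<open>m\<close>, as
  \<open>ladder_scalars\<close> requires of a rung; the coefficient of \<open>\<psi>\<close> is what makes its product with the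
  mixed derivative of \<open>\<psi>\<close> the mixed derivative of \<open>f\<close>.
\<close>

definition frame_section :: "('a \<Rightarrow> complex) \<Rightarrow> ('a \<Rightarrow> complex) \<Rightarrow> 'a \<Rightarrow> complex ^ 5" where
  "frame_section f m q = (- 2 * dzb (dz f) q - 4 * f q * (k q)\<^sup>2) *s \<psi> q + (2 * dzb f q) *s vz \<psi> q
    + (2 * dz f q) *s vzb \<psi> q - (2 * f q) *s vzb (vz \<psi>) q + m q *s N q"

lemma smooth_frame_section: "sm f \<Longrightarrow> sm m \<Longrightarrow> smooth_vec (frame_section f m)"
  unfolding frame_section_def[abs_def] by (intro smooth_vec_intros smooth_intros frame_smooth)

lemma frame_section_real:
  assumes "sm f" and "\<And>q. q \<in> S \<Longrightarrow> cnj (f q) = f q" and "\<And>q. q \<in> S \<Longrightarrow> cnj (m q) = m q"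
    and p: "p \<in> S"
  shows "vcnj (frame_section f m p) = frame_section f m p"
  using p by (simp add: frame_section_def real conj_psi conj_mixed assms laplacian_real wirtinger_real)

lemma frame_section_products:
  assumes p: "p \<in> S"
  shows "lor (\<psi> p) (frame_section f m p) = f p" and "lor (vzb \<psi> p) (frame_section f m p) = dzb f p"
    and "lor (N p) (frame_section f m p) = m p"
  by (simp_all add: frame_section_def gram p)

text \<open>The structure equations of the frame, collected.\<close>

lemma vz_frame_combination:
  assumes "sm a0" "sm a1" "sm a2" "sm a3" "sm a4" and p: "p \<in> S"
  shows "vz (\<lambda>q. a0 q *s \<psi> q + a1 q *s vz \<psi> q + a2 q *s vzb \<psi> q - a3 q *s vzb (vz \<psi>) q + a4 q *s N q) p
    = (a0 p *s vz \<psi> p + dz a0 p *s \<psi> p)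
    + (a1 p *s (k p *s N p - (c p / 2) *s \<psi> p) + dz a1 p *s vz \<psi> p)
    + (a2 p *s vzb (vz \<psi>) p + dz a2 p *s vzb \<psi> p)
    - (a3 p *s (dzb k p *s N p - (2 * k p * dz k p) *s \<psi> p
        - (2 * (k p)\<^sup>2) *s vz \<psi> p - (c p / 2) *s vzb \<psi> p) + dz a3 p *s vzb (vz \<psi>) p)
    + (a4 p *s ((2 * dzb k p) *s \<psi> p - (2 * k p) *s vzb \<psi> p) + dz a4 p *s N p)"
  by (simp only: vec_wirtinger_add vec_wirtinger_diff vec_wirtinger_scale smooth_vec_add smooth_vec_diff
      smooth_vec_scale assms frame_smooth vz_N vz_mixed' vz_vz_psi vz_vzb_psi)

text \<open>
  In the derivative of the section the components along \<open>\<psi>\<^sub>z\<close> and the mixed derivative cancel, the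
  component along \<open>N\<close> vanishes by \<open>dm\<close>, and the one along \<open>\<psi>\<^sub>z\<^sub>b\<^sub>a\<^sub>r\<close> is \<open>g\<close> by \<open>eq\<close>. The component along \<open>\<psi>\<close> is then
  \<open>- g\<^sub>z\<^sub>b\<^sub>a\<^sub>r\<close>: this is the conjugate derivative of \<open>eq\<close>, simplified by the Gauss equation and the conjugate of \<open>dm\<close>.
  The value \<open>n\<close> is free because \<open>\<eta>\<close> annihilates \<open>N\<close>.
\<close>

lemma ladder_frame_section:
  assumes f: "sm f" and g: "sm g" and m: "sm m" and m_real: "\<And>q. q \<in> S \<Longrightarrow> cnj (m q) = m q"
    and f_real: "\<And>q. q \<in> S \<Longrightarrow> cnj (f q) = f q"
    and dm: "\<And>q. q \<in> S \<Longrightarrow> dz m q = 2 * f q * dzb k q - 2 * k q * dzb f q"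
    and eq: "\<And>q. q \<in> S \<Longrightarrow> 2 * dz (dz f) q + c q * f q - 2 * m q * k q = g q"
  shows "ladder (frame_section g n) (frame_section f m)"
  unfolding ladder_def
proof
  fix p assume p: "p \<in> S"
  have dmb: "dzb m p = 2 * f p * dz k p - 2 * k p * dz f p"
    using wirtinger_real(1)[OF m m_real p] dm[OF p] by (simp add: real f_real conj_k wirtinger_real f p)
  have "dzb g p = dzb (\<lambda>q. 2 * dz (dz f) q + c q * f q - 2 * m q * k q) p"
    by (rule wirtinger_cong) (simp_all add: eq p)
  then have dg: "dzb g p = 2 * dzb (dz (dz f)) p + 4 * k p * f p * dz k p + c p * dzb f p
      + 4 * (k p)\<^sup>2 * dz f p - 2 * m p * dzb k p"
    by (simp add: wirtinger_add wirtinger_diff wirtinger_mult wirtinger_const smooth_intros smooth f m p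
        gauss dmb algebra_simps power2_eq_square)
  have comm: "dz (dzb f) p = dzb (dz f) p" "dz (dzb (dz f)) p = dzb (dz (dz f)) p"
    by (simp_all add: wirtinger_commute f p smooth_dz)
  have "vz (frame_section f m) p = g p *s vzb \<psi> p - dzb g p *s \<psi> p"
    unfolding frame_section_def[abs_def]
    by (subst vz_frame_combination)
       (intro smooth_intros f m smooth p; fail |
        simp add: wirtinger_diff wirtinger_power wirtinger_minus wirtinger_mult wirtinger_const
          smooth_mult smooth_minus smooth_power smooth_dz smooth_dzb smooth_const smooth f m p comm dm,
        simp add: vec_eq_iff algebra_simps power2_eq_square dg eq[OF p, symmetric])+
  then show "vz (frame_section f m) p = lor (\<psi> p) (frame_section g n p) *s vzb \<psi> p
      - lor (vzb \<psi> p) (frame_section g n p) *s \<psi> p"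
    by (simp add: frame_section_products p)
qed

text \<open>
  The descent of \<open>equation_of_ladder\<close> read backwards, with the leading constant normalised to 1, so that
  the top section is \<open>N\<close>.
\<close>

lemma ladder_of_equation:
  fixes s1 s2 :: real
  assumes eq: "\<And>p. p \<in> S \<Longrightarrow>
    2 * dz (dz \<delta>) p + c p * \<delta> p + 4 * \<mu> p * k p + complex_of_real s1 * \<delta> p + complex_of_real s2 * k p = 0"
  obtains P0 P1 P2 where "smooth_vec P0" "smooth_vec P1" "smooth_vec P2"
    and "\<And>q. q \<in> S \<Longrightarrow> vcnj (P0 q) = P0 q" "\<And>q. q \<in> S \<Longrightarrow> vcnj (P1 q) = P1 q"
      "\<And>q. q \<in> S \<Longrightarrow> vcnj (P2 q) = P2 q"
    and "ladder (\<lambda>q. 0) P0" "ladder P0 P1" "ladder P1 P2" "ladder P2 (\<lambda>q. 0)"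
    and "\<And>q. q \<in> S \<Longrightarrow> P2 q \<noteq> 0"
proof -
  define f0 where "f0 = (\<lambda>q. - 2 * \<delta> q - 2 * complex_of_real s1 * k q)"
  define f1 where "f1 = (\<lambda>q. - 2 * k q)"
  define m0 where "m0 = (\<lambda>q. 4 * \<mu> q + complex_of_real s2)"
  have sm: "sm f0" "sm f1" "sm m0"
    unfolding f0_def f1_def m0_def by (intro smooth_intros smooth smooth_\<delta> smooth_\<mu>)+
  have re: "cnj (f0 q) = f0 q" "cnj (f1 q) = f1 q" "cnj (m0 q) = m0 q" if "q \<in> S" for q
    using that by (simp_all add: f0_def f1_def m0_def \<delta>_real \<mu>_real real)
  have d1: "dz f1 q = - 2 * dz k q" "dzb f1 q = - 2 * dzb k q" if "q \<in> S" for q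
    unfolding f1_def using that by (simp_all add: wirtinger_mult wirtinger_minus smooth_minus wirtinger_const smooth_mult smooth_const smooth)
  have dd1: "dz (dz f1) q = - 2 * dz (dz k) q" if "q \<in> S" for q
    using wirtinger_cong(1)[OF d1(1) that] that
    by (simp add: wirtinger_mult wirtinger_minus smooth_minus wirtinger_const smooth_mult smooth_const smooth smooth_dz)
  have d0: "dz f0 q = - 2 * dz \<delta> q - 2 * s1 * dz k q" "dzb f0 q = - 2 * dzb \<delta> q - 2 * s1 * dzb k q"
    if "q \<in> S" for q
    unfolding f0_def using that
    by (simp_all add: wirtinger_diff wirtinger_mult wirtinger_minus smooth_minus wirtinger_const smooth_mult smooth_const smooth smooth_\<delta> smooth_mult)
  have dd0: "dz (dz f0) q = - 2 * dz (dz \<delta>) q - 2 * s1 * dz (dz k) q" if "q \<in> S" for q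
    using wirtinger_cong(1)[OF d0(1) that] that
    by (simp add: wirtinger_diff wirtinger_mult wirtinger_minus smooth_minus wirtinger_const smooth_mult smooth_const smooth smooth_\<delta> smooth_mult smooth_dz)
  have dm0: "dz m0 q = 4 * dz \<mu> q" if "q \<in> S" for q
    unfolding m0_def using that
    by (simp add: wirtinger_add wirtinger_mult wirtinger_minus smooth_minus wirtinger_const smooth_mult smooth_const smooth_mult smooth_\<mu>)
  have z: "dz (\<lambda>q. 0) = (\<lambda>q. 0)" "dzb (\<lambda>q. 0) = (\<lambda>q. 0)"
    by (simp_all add: fun_eq_iff wirtinger_const)
  have zs: "frame_section (\<lambda>q. 0) (\<lambda>q. 0) = (\<lambda>q. 0)"
    by (simp add: frame_section_def fun_eq_iff z)
  have "ladder (frame_section (\<lambda>q. 0) (\<lambda>q. 0)) (frame_section f0 m0)"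
  proof (rule ladder_frame_section[OF sm(1) smooth_const sm(3) re(3,1)])
    fix q assume q: "q \<in> S"
    show "dz m0 q = 2 * f0 q * dzb k q - 2 * k q * dzb f0 q"
      by (simp add: dm0 d0 dz_\<mu> q) (simp add: f0_def algebra_simps)
    have "2 * dz (dz f0) q + c q * f0 q - 2 * m0 q * k q = - 2 * (2 * dz (dz \<delta>) q + c q * \<delta> q
        + 4 * \<mu> q * k q + s1 * \<delta> q + s2 * k q)"
      by (simp add: dd0 q) (simp add: f0_def m0_def \<delta>_def[of q] algebra_simps)
    then show "2 * dz (dz f0) q + c q * f0 q - 2 * m0 q * k q = 0"
      by (simp only: eq[OF q] mult_zero_right)
  qed
  moreover have "ladder (frame_section f0 m0) (frame_section f1 (\<lambda>q. s1))"
    by (rule ladder_frame_section[OF sm(2,1) smooth_const _ re(2)])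
       (simp_all add: d1 dd1 wirtinger_const, simp_all add: f0_def f1_def \<delta>_def algebra_simps)
  moreover have "ladder (frame_section f1 (\<lambda>q. s1)) (frame_section (\<lambda>q. 0) (\<lambda>q. 1))"
    by (rule ladder_frame_section[OF smooth_const sm(2) smooth_const])
       (simp_all add: z wirtinger_const f1_def)
  moreover have "ladder (frame_section (\<lambda>q. 0) (\<lambda>q. 1)) (\<lambda>q. 0)"
    by (simp add: ladder_def frame_section_products z vec_z_def vec_eq_iff)
  moreover have "frame_section (\<lambda>q. 0) (\<lambda>q. 1) q \<noteq> 0" if "q \<in> S" for q
    using frame_section_products(3)[OF that, of "\<lambda>q. 0" "\<lambda>q. 1"] by auto
  ultimately show ?thesis
    by (intro that[of "frame_section f0 m0" "frame_section f1 (\<lambda>q. s1)" "frame_section (\<lambda>q. 0) (\<lambda>q. 1)"])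
       (simp_all add: smooth_frame_section frame_section_real sm re smooth_const zs)
qed

end

section \<open>Separating the powers of the spectral parameter\<close>

lemma cubic_vector_polynomial_zero:
  fixes a b c d :: "'v::real_vector"
  assumes "\<And>t::real. a + t *\<^sub>R b + t\<^sup>2 *\<^sub>R c + t ^ 3 *\<^sub>R d = 0"
  shows "a = 0" "b = 0" "c = 0" "d = 0"
proof -
  have a: "a = 0" using assms[of 0] by simp
  have 1: "b + c + d = 0" using assms[of 1] a by simp
  have 2: "- b + c - d = 0" using assms[of "-1"] a by simp
  have 3: "2 *\<^sub>R b + 4 *\<^sub>R c + 8 *\<^sub>R d = 0" using assms[of 2] a by simp
  have "2 *\<^sub>R c = (b + c + d) + (- b + c - d)" by (simp add: scaleR_2)
  then have c: "c = 0" using 1 2 by simp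
  have "6 *\<^sub>R d = (2 *\<^sub>R b + 4 *\<^sub>R c + 8 *\<^sub>R d) - 2 *\<^sub>R (b + c + d) - 2 *\<^sub>R c"
    by (simp add: algebra_simps) (simp flip: scaleR_add_left)
  then have d: "d = 0" using 1 3 c by simp
  show "a = 0" "b = 0" "c = 0" "d = 0" using a 1 c d by simp_all
qed

lemma real_linear_zero:
  fixes a b :: complex
  assumes "\<And>\<xi>. \<xi> * a + cnj \<xi> * b = 0"
  shows "a = 0"
  using assms[of 1] assms[of \<i>] by (simp flip: right_diff_distrib)

context coordinate_surface
begin

lemma flat_d_quadratic:
  fixes P :: "nat \<Rightarrow> 'a \<Rightarrow> 'b::real_normed_vector"
  assumes "\<And>i. i \<le> 2 \<Longrightarrow> sm (P i)" and p: "p \<in> S"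
  shows "dd (\<lambda>q. \<Sum>i\<le>2. t ^ i *\<^sub>R P i q) p \<xi>
    = dd (P 0) p \<xi> + t *\<^sub>R dd (P 1) p \<xi> + t\<^sup>2 *\<^sub>R dd (P 2) p \<xi>"
proof -
  have s: "sm (P 0)" "sm (P 1)" "sm (P 2)" using assms(1) by simp_all
  have r: "sm (\<lambda>q. r *\<^sub>R P i q)" "dd (\<lambda>q. r *\<^sub>R P i q) p \<xi> = r *\<^sub>R dd (P i) p \<xi>" if "sm (P i)" for r i
    using smooth_bounded_linear[OF bounded_linear_scaleR_right that]
      flat_d_bounded_linear[OF bounded_linear_scaleR_right that p] by simp_all
  have "(\<lambda>q. \<Sum>i\<le>2. t ^ i *\<^sub>R P i q) = (\<lambda>q. P 0 q + t *\<^sub>R P 1 q + t\<^sup>2 *\<^sub>R P 2 q)"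
    by (simp add: numeral_2_eq_2 fun_eq_iff)
  then show ?thesis
    by (simp add: flat_d_add smooth_add s r p del: One_nat_def)
qed

end

context isothermic_frame
begin

lemma dz_dz_\<delta>:
  assumes p: "p \<in> S"
  shows "dz (dz \<delta>) p = 2 * dz (dz (dz (dz k))) p + c p * dz (dz k) p + 2 * dz c p * dz k p + dz (dz c) p * k p"
proof -
  have "dz \<delta> q = 2 * dz (dz (dz k)) q + (c q * dz k q + dz c q * k q)" if "q \<in> S" for q
    unfolding \<delta>_def[abs_def] using that
    by (simp add: wirtinger_add wirtinger_mult wirtinger_const smooth_intros smooth)
  from wirtinger_cong(1)[OF this p] show ?thesis
    using p by (simp add: wirtinger_add wirtinger_mult wirtinger_const smooth_intros smooth)
qed

text \<open>
  The rearrangement of the fourth order equation in terms of \<open>\<delta>\<close> and \<open>\<mu>\<close> in which it appears as the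
  last rung of the ladder.
\<close>

lemma equation_normal_form:
  assumes p: "p \<in> S"
  shows "4 * dz (dz (dz (dz k))) p + 4 * c p * dz (dz k) p + 4 * dz c p * dz k p
      + (2 * dz (dz c) p + (c p)\<^sup>2) * k p
      + 8 * (dzb (dz k) p * k p + (k p) ^ 4 - dz k p * dzb k p) * k p
      + complex_of_real s1 * (2 * dz (dz k) p + c p * k p) + complex_of_real s2 * k p
    = 2 * dz (dz \<delta>) p + c p * \<delta> p + 4 * \<mu> p * k p + complex_of_real s1 * \<delta> p + complex_of_real s2 * k p"
  by (simp add: dz_dz_\<delta> p) (simp add: \<delta>_def \<mu>_def algebra_simps power2_eq_square)

context
  fixes \<eta> :: "'a \<Rightarrow> complex \<Rightarrow> real ^ 5 \<Rightarrow> real ^ 5"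
  assumes eta: "\<And>p \<xi> w. p \<in> S \<Longrightarrow>
      cvec (\<eta> p \<xi> w) = - wedge (\<psi> p) (\<xi> *s vzb \<psi> p + cnj \<xi> *s vz \<psi> p) (cvec w)"
begin

text \<open>
  The left-hand side evaluated on \<open>\<xi>\<close> is \<open>\<xi> A + cnj \<xi> cnj A\<close>, where \<open>A\<close> is the difference of the two sides of the
  rung; such a form vanishes for all \<open>\<xi>\<close> only if \<open>A = 0\<close>.
\<close>

lemma parallel_iff_ladder:
  assumes P: "sm P" and Q: "sm Q"
  shows "(\<forall>p\<in>S. \<forall>\<xi>. dd Q p \<xi> + \<eta> p \<xi> (P p) = 0) \<longleftrightarrow>
    ladder (\<lambda>q. cvec (P q)) (\<lambda>q. cvec (Q q))"
proof -
  let ?P = "\<lambda>q. cvec (P q)" and ?Q = "\<lambda>q. cvec (Q q)"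
  let ?A = "\<lambda>p. vz ?Q p - (lor (\<psi> p) (?P p) *s vzb \<psi> p - lor (vzb \<psi> p) (?P p) *s \<psi> p)"
  have conj_A: "vcnj (?A p) = vzb ?Q p - (lor (\<psi> p) (?P p) *s vz \<psi> p - lor (vz \<psi> p) (?P p) *s \<psi> p)"
    if p: "p \<in> S" for p
    using lor_vcnj[of "\<psi> p" "?P p"] lor_vcnj[of "vzb \<psi> p" "?P p"] 
      vec_wirtinger_real(1)[OF smooth_cvec[OF Q] _ p] conj_psi[OF p] real by simp
  have key: "cvec (dd Q p \<xi> + \<eta> p \<xi> (P p)) = \<xi> *s ?A p + cnj \<xi> *s vcnj (?A p)" if p: "p \<in> S" for p \<xi>
    unfolding conj_A[OF p]
    by (simp add: cvec_flat_d Q p eta wedge_def vec_eq_iff algebra_simps)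
  have "(\<forall>\<xi>. dd Q p \<xi> + \<eta> p \<xi> (P p) = 0) \<longleftrightarrow> ?A p = 0" if p: "p \<in> S" for p
  proof
    assume "\<forall>\<xi>. dd Q p \<xi> + \<eta> p \<xi> (P p) = 0"
    then have z: "\<xi> *s ?A p + cnj \<xi> *s vcnj (?A p) = 0" for \<xi>
      unfolding key[OF p, symmetric] by simp
    have "?A p $ j = 0" for j
    proof (rule real_linear_zero)
      show "\<xi> * ?A p $ j + cnj \<xi> * cnj (?A p $ j) = 0" for \<xi>
        using arg_cong[OF z[of \<xi>], of "\<lambda>v. v $ j"]
        unfolding vector_add_component vector_smult_component vcnj_component zero_index .
    qed
    then show "?A p = 0" by (simp add: vec_eq_iff)
  next
    assume e: "?A p = 0"
    then have "cvec (dd Q p \<xi> + \<eta> p \<xi> (P p)) = 0" for \<xi>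
      by (simp only: key[OF p] e) (simp add: vec_eq_iff)
    then show "\<forall>\<xi>. dd Q p \<xi> + \<eta> p \<xi> (P p) = 0"
      unfolding cvec_simps(5) by blast
  qed
  then show ?thesis by (simp add: ladder_def)
qed

lemma quadratic_conserved_iff:
  assumes sP: "\<And>i. i \<le> 2 \<Longrightarrow> sm (P i)"
  shows "(\<forall>t::real. \<forall>p\<in>S. \<forall>\<xi>. dd (\<lambda>q. \<Sum>i\<le>2. t ^ i *\<^sub>R P i q) p \<xi>
             + t *\<^sub>R \<eta> p \<xi> (\<Sum>i\<le>2. t ^ i *\<^sub>R P i p) = 0)
    \<longleftrightarrow> ladder (\<lambda>q. 0) (\<lambda>q. cvec (P 0 q)) \<and> ladder (\<lambda>q. cvec (P 0 q)) (\<lambda>q. cvec (P 1 q))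
      \<and> ladder (\<lambda>q. cvec (P 1 q)) (\<lambda>q. cvec (P 2 q)) \<and> ladder (\<lambda>q. cvec (P 2 q)) (\<lambda>q. 0)"
    (is "?L \<longleftrightarrow> ?R")
proof -
  have s: "sm (P 0)" "sm (P 1)" "sm (P 2)" "sm (\<lambda>q. 0 :: real ^ 5)"
    using sP by (simp_all add: smooth_const)
  have e0: "\<eta> p \<xi> 0 = 0" if "p \<in> S" for p \<xi>
    using eta[OF that, of \<xi> 0] by (simp add: wedge_def)
  have es: "\<eta> p \<xi> (a + r *\<^sub>R b + r' *\<^sub>R d) = \<eta> p \<xi> a + r *\<^sub>R \<eta> p \<xi> b + r' *\<^sub>R \<eta> p \<xi> d" if "p \<in> S" for p \<xi> a b d r r'
  proof -
    have "cvec (\<eta> p \<xi> (a + r *\<^sub>R b + r' *\<^sub>R d)) = cvec (\<eta> p \<xi> a + r *\<^sub>R \<eta> p \<xi> b + r' *\<^sub>R \<eta> p \<xi> d)"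
      using that by (simp add: eta wedge_def vec_eq_iff algebra_simps)
    then show ?thesis by (rule cvec_simps(4)[THEN iffD1])
  qed
  have expand: "dd (\<lambda>q. \<Sum>i\<le>2. t ^ i *\<^sub>R P i q) p \<xi> + t *\<^sub>R \<eta> p \<xi> (\<Sum>i\<le>2. t ^ i *\<^sub>R P i p)
      = dd (P 0) p \<xi> + t *\<^sub>R (dd (P 1) p \<xi> + \<eta> p \<xi> (P 0 p)) + t\<^sup>2 *\<^sub>R (dd (P 2) p \<xi> + \<eta> p \<xi> (P 1 p))
        + t ^ 3 *\<^sub>R \<eta> p \<xi> (P 2 p)" if "p \<in> S" for t p \<xi>
  proof -
    have "(\<Sum>i\<le>2. t ^ i *\<^sub>R P i p) = P 0 p + t *\<^sub>R P 1 p + t\<^sup>2 *\<^sub>R P 2 p"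
      by (simp add: numeral_2_eq_2)
    then show ?thesis
      by (simp only: es[OF that] flat_d_quadratic[of P p t \<xi>, OF sP that]) (simp add: algebra_simps power2_eq_square power3_eq_cube)
  qed
  have "?L \<longleftrightarrow> (\<forall>p\<in>S. \<forall>\<xi>. dd (P 0) p \<xi> = 0 \<and> dd (P 1) p \<xi> + \<eta> p \<xi> (P 0 p) = 0
      \<and> dd (P 2) p \<xi> + \<eta> p \<xi> (P 1 p) = 0 \<and> \<eta> p \<xi> (P 2 p) = 0)" (is "_ \<longleftrightarrow> ?M")
  proof
    assume L: ?L
    show ?M
    proof (intro ballI allI)
      fix p \<xi> assume p: "p \<in> S"
      have "dd (P 0) p \<xi> + t *\<^sub>R (dd (P 1) p \<xi> + \<eta> p \<xi> (P 0 p)) + t\<^sup>2 *\<^sub>R (dd (P 2) p \<xi> + \<eta> p \<xi> (P 1 p))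
        + t ^ 3 *\<^sub>R \<eta> p \<xi> (P 2 p) = 0" for t
        unfolding expand[OF p, symmetric] using L p by simp
      from cubic_vector_polynomial_zero[OF this]
      show "dd (P 0) p \<xi> = 0 \<and> dd (P 1) p \<xi> + \<eta> p \<xi> (P 0 p) = 0
        \<and> dd (P 2) p \<xi> + \<eta> p \<xi> (P 1 p) = 0 \<and> \<eta> p \<xi> (P 2 p) = 0" by blast
    qed
  next
    assume ?M
    then show ?L by (simp add: expand)
  qed
  also have "\<dots> \<longleftrightarrow> ?R"
    using parallel_iff_ladder[OF s(4,1)] parallel_iff_ladder[OF s(1,2)] parallel_iff_ladder[OF s(2,3)]
      parallel_iff_ladder[OF s(3,4)]
    by (simp add: e0 flat_d_const) blast
  finally show ?thesis .
qed

end

lemma conserved_quadratic_iff_equation: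
  assumes eta: "\<And>p \<xi> w. p \<in> S \<Longrightarrow>
      cvec (\<eta> p \<xi> w) = - wedge (\<psi> p) (\<xi> *s vzb \<psi> p + cnj \<xi> *s vz \<psi> p) (cvec w)"
    and "S \<noteq> {}"
  shows "(\<exists>P :: nat \<Rightarrow> 'a \<Rightarrow> real ^ 5. (\<forall>i\<le>2. sm (P i)) \<and> (\<exists>p\<in>S. P 2 p \<noteq> 0) \<and>
      (\<forall>t::real. \<forall>p\<in>S. \<forall>\<xi>. dd (\<lambda>q. \<Sum>i\<le>2. t ^ i *\<^sub>R P i q) p \<xi>
             + t *\<^sub>R \<eta> p \<xi> (\<Sum>i\<le>2. t ^ i *\<^sub>R P i p) = 0))
    \<longleftrightarrow> (\<exists>s1 s2 :: real. \<forall>p\<in>S.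
      2 * dz (dz \<delta>) p + c p * \<delta> p + 4 * \<mu> p * k p + complex_of_real s1 * \<delta> p + complex_of_real s2 * k p = 0)"
    (is "?L \<longleftrightarrow> ?R")
proof
  assume ?L
  then obtain P :: "nat \<Rightarrow> 'a \<Rightarrow> real ^ 5" and p0 where sP: "\<And>i. i \<le> 2 \<Longrightarrow> sm (P i)"
    and p0: "p0 \<in> S" "P 2 p0 \<noteq> 0"
    and "\<forall>t::real. \<forall>p\<in>S. \<forall>\<xi>. dd (\<lambda>q. \<Sum>i\<le>2. t ^ i *\<^sub>R P i q) p \<xi>
             + t *\<^sub>R \<eta> p \<xi> (\<Sum>i\<le>2. t ^ i *\<^sub>R P i p) = 0"
    by blast
  then have lad: "ladder (\<lambda>q. 0) (\<lambda>q. cvec (P 0 q))" "ladder (\<lambda>q. cvec (P 0 q)) (\<lambda>q. cvec (P 1 q))"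
    "ladder (\<lambda>q. cvec (P 1 q)) (\<lambda>q. cvec (P 2 q))" "ladder (\<lambda>q. cvec (P 2 q)) (\<lambda>q. 0)"
    using quadratic_conserved_iff[of \<eta> P, OF eta sP] by blast+
  have s: "smooth_vec (\<lambda>q. cvec (P i q))" if "i \<le> 2" for i
    using smooth_cvec sP that by blast
  obtain s1 s2 :: real where "\<And>p. p \<in> S \<Longrightarrow> 2 * dz (dz \<delta>) p + c p * \<delta> p + 4 * \<mu> p * k p
      + complex_of_real s1 * \<delta> p + complex_of_real s2 * k p = 0"
    by (rule equation_of_ladder[OF s s s _ _ _ lad p0(1)]) (use p0(2) in auto)
  then show ?R by blast
next
  assume ?R
  then obtain s1 s2 :: real where eq: "\<And>p. p \<in> S \<Longrightarrow> 2 * dz (dz \<delta>) p + c p * \<delta> p + 4 * \<mu> p * k p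
      + complex_of_real s1 * \<delta> p + complex_of_real s2 * k p = 0"
    by blast
  obtain P0 P1 P2 where s: "smooth_vec P0" "smooth_vec P1" "smooth_vec P2"
    and r: "\<And>q. q \<in> S \<Longrightarrow> vcnj (P0 q) = P0 q" "\<And>q. q \<in> S \<Longrightarrow> vcnj (P1 q) = P1 q"
      "\<And>q. q \<in> S \<Longrightarrow> vcnj (P2 q) = P2 q"
    and lad: "ladder (\<lambda>q. 0) P0" "ladder P0 P1" "ladder P1 P2" "ladder P2 (\<lambda>q. 0)"
    and nz: "\<And>q. q \<in> S \<Longrightarrow> P2 q \<noteq> 0"
    using ladder_of_equation[OF eq] by blast
  obtain Q0 where Q0: "sm Q0" "\<And>q. q \<in> S \<Longrightarrow> cvec (Q0 q) = P0 q"
    using real_section[OF s(1) r(1)] by blast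
  obtain Q1 where Q1: "sm Q1" "\<And>q. q \<in> S \<Longrightarrow> cvec (Q1 q) = P1 q"
    using real_section[OF s(2) r(2)] by blast
  obtain Q2 where Q2: "sm Q2" "\<And>q. q \<in> S \<Longrightarrow> cvec (Q2 q) = P2 q"
    using real_section[OF s(3) r(3)] by blast
  define P where "P i = (if i = 0 then Q0 else if i = 1 then Q1 else Q2)" for i :: nat
  have sP: "sm (P i)" for i
    using Q0 Q1 Q2 by (simp add: P_def)
  have vzQ: "vz (\<lambda>q. cvec (Q0 q)) p = vz P0 p" "vz (\<lambda>q. cvec (Q1 q)) p = vz P1 p"
    "vz (\<lambda>q. cvec (Q2 q)) p = vz P2 p" if "p \<in> S" for p
    using that by (auto intro!: vec_wirtinger_cong(1) simp: Q0 Q1 Q2)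
  have "ladder (\<lambda>q. 0) (\<lambda>q. cvec (P 0 q)) \<and> ladder (\<lambda>q. cvec (P 0 q)) (\<lambda>q. cvec (P 1 q))
      \<and> ladder (\<lambda>q. cvec (P 1 q)) (\<lambda>q. cvec (P 2 q)) \<and> ladder (\<lambda>q. cvec (P 2 q)) (\<lambda>q. 0)"
    using lad by (simp add: ladder_def P_def vzQ Q0 Q1 Q2)
  then have "\<forall>t::real. \<forall>p\<in>S. \<forall>\<xi>. dd (\<lambda>q. \<Sum>i\<le>2. t ^ i *\<^sub>R P i q) p \<xi>
             + t *\<^sub>R \<eta> p \<xi> (\<Sum>i\<le>2. t ^ i *\<^sub>R P i p) = 0"
    using quadratic_conserved_iff[of \<eta> P, OF eta sP] by blast
  moreover have "\<exists>p\<in>S. P 2 p \<noteq> 0"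
  proof -
    obtain p where p: "p \<in> S" using \<open>S \<noteq> {}\<close> by blast
    then have "cvec (Q2 p) \<noteq> 0" using nz Q2 by simp
    then show ?thesis using p by (auto simp: P_def)
  qed
  ultimately show ?L using sP by blast
qed

end


section \<open>Surfaces in the conformal 3-sphere\<close>

lemma null_line_member:
  assumes "L \<in> null_lines" and "x \<in> L"
  shows "lor x x = 0"
proof -
  obtain y where "lor y y = 0" and "L = span {y}"
    using assms(1) by (auto simp: null_lines_def light_cone_def)
  then obtain r where "x = r *\<^sub>R y"
    using assms(2) by (auto simp: span_singleton)
  then have "lor x x = r\<^sup>2 * lor y y"
    by (simp add: lor_def algebra_simps power2_eq_square)
  with \<open>lor y y = 0\<close> show ?thesis by simp
qed

text \<open>
  Comparing \<open>\<xi>\<^sup>2 (\<sigma>\<^sub>z, \<sigma>\<^sub>z) + 2 |\<xi>|\<^sup>2 (\<sigma>\<^sub>z, \<sigma>\<^sub>z\<^sub>b\<^sub>a\<^sub>r) + cnj \<xi>\<^sup>2 (\<sigma>\<^sub>z\<^sub>b\<^sub>a\<^sub>r, \<sigma>\<^sub>z\<^sub>b\<^sub>a\<^sub>r) = |\<xi>|\<^sup>2\<close> at \<open>\<xi> = 1\<close>, \<open>\<i>\<close>, \<open>1 + \<i>\<close>.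
\<close>

lemma (in coordinate_surface) conformal_products:
  assumes \<sigma>: "sm \<sigma>" and p: "p \<in> S" and "\<And>\<xi>. lor (dd \<sigma> p \<xi>) (dd \<sigma> p \<xi>) = (cmod \<xi>)\<^sup>2"
  shows "lor (vz (\<lambda>q. cvec (\<sigma> q)) p) (vz (\<lambda>q. cvec (\<sigma> q)) p) = 0"
    and "lor (vz (\<lambda>q. cvec (\<sigma> q)) p) (vzb (\<lambda>q. cvec (\<sigma> q)) p) = 1 / 2"
proof -
  define u v where "u = vz (\<lambda>q. cvec (\<sigma> q)) p" and "v = vzb (\<lambda>q. cvec (\<sigma> q)) p"
  have e: "\<xi>\<^sup>2 * lor u u + 2 * (\<xi> * cnj \<xi>) * lor u v + (cnj \<xi>)\<^sup>2 * lor v v = (cmod \<xi>)\<^sup>2" for \<xi>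
    using lor_cvec[of "dd \<sigma> p \<xi>" "dd \<sigma> p \<xi>"] assms(3)[of \<xi>]
    unfolding cvec_flat_d[OF \<sigma> p] u_def[symmetric] v_def[symmetric]
    by (simp add: lor_commute[of v u] algebra_simps power2_eq_square)
  have 1: "lor u u + 2 * lor u v + lor v v = 1" using e[of 1] by simp
  have 2: "- lor u u + 2 * lor u v - lor v v = 1" using e[of \<i>] by simp
  have "4 * lor u v = (lor u u + 2 * lor u v + lor v v) + (- lor u u + 2 * lor u v - lor v v)" by simp
  then have b: "lor u v = 1 / 2" unfolding 1 2 by (simp add: eq_divide_eq mult.commute)
  have "2 * \<i> * lor u u + 4 * lor u v - 2 * \<i> * lor v v = 2"
    using e[of "1 + \<i>"] by (simp add: power2_eq_square algebra_simps cmod_def)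
  then have "lor u u = lor v v" using b by simp
  moreover have "lor u u + lor v v = 0" using 1 b by simp
  ultimately have "lor u u = 0" by simp
  then show "lor (vz (\<lambda>q. cvec (\<sigma> q)) p) (vz (\<lambda>q. cvec (\<sigma> q)) p) = 0"
    "lor (vz (\<lambda>q. cvec (\<sigma> q)) p) (vzb (\<lambda>q. cvec (\<sigma> q)) p) = 1 / 2"
    using b by (simp_all add: u_def v_def)
qed

text \<open>
  The central sphere is defined by its real vectors, so orthogonality has to be tested on real
  vectors first: the values of \<open>d\<sigma>\<close>, which recover \<open>\<sigma>\<^sub>z\<close>, and the mixed derivative, which is real.
\<close>

lemma (in coordinate_surface) orth_central_sphere:
  assumes \<sigma>: "sm \<sigma>" and p: "p \<in> S" and n: "n \<in> orth (central_sphere X z \<sigma> p)"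
  shows "lor (cvec n) (cvec (\<sigma> p)) = 0" and "lor (cvec n) (vz (\<lambda>q. cvec (\<sigma> q)) p) = 0"
    and "lor (cvec n) (vzb (vz (\<lambda>q. cvec (\<sigma> q))) p) = 0"
proof -
  let ?\<Sigma> = "\<lambda>q. cvec (\<sigma> q)"
  let ?B = "{?\<Sigma> p, vz ?\<Sigma> p, vzb ?\<Sigma> p, vzb (vz ?\<Sigma>) p}"
  have o: "lor (cvec n) (cvec w) = 0" if "cvec w \<in> vec.span ?B" for w
    using n that by (simp add: orth_def central_sphere_def Let_def lor_cvec)
  show "lor (cvec n) (cvec (\<sigma> p)) = 0"
    by (rule o) (simp add: vec.span_base)
  have "cvec (dd \<sigma> p \<xi>) \<in> vec.span ?B" for \<xi>
    unfolding cvec_flat_d[OF \<sigma> p] by (intro vec.span_add vec.span_scale vec.span_base) simp_all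
  from o[OF this] have e: "\<xi> * lor (cvec n) (vz ?\<Sigma> p) + cnj \<xi> * lor (cvec n) (vzb ?\<Sigma> p) = 0" for \<xi>
    by (simp add: cvec_flat_d[OF \<sigma> p])
  show "lor (cvec n) (vz ?\<Sigma> p) = 0"
    by (rule real_linear_zero[OF e])
  have "vcnj (vzb (vz ?\<Sigma>) p) = vzb (vz ?\<Sigma>) p"
    by (rule vec_laplacian_real[OF smooth_cvec[OF \<sigma>] _ p]) simp
  then have w: "cvec (\<chi> j. Re (vzb (vz ?\<Sigma>) p $ j)) = vzb (vz ?\<Sigma>) p"
    by (simp add: vec_eq_iff complex_eq_iff)
  then show "lor (cvec n) (vzb (vz ?\<Sigma>) p) = 0"
    using o[of "\<chi> j. Re (vzb (vz ?\<Sigma>) p $ j)"] by (simp add: vec.span_base)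
qed

theorem proposition3p6:
  fixes X :: "'a topology"
    and A :: "('a set \<times> ('a \<Rightarrow> complex)) set"
    and z :: "'a \<Rightarrow> complex"
    and \<Lambda> :: "'a \<Rightarrow> (real ^ 5) set"
    and \<eta> :: "'a \<Rightarrow> complex \<Rightarrow> real ^ 5 \<Rightarrow> real ^ 5"
    and \<psi> N :: "'a \<Rightarrow> real ^ 5"
    and c :: "'a \<Rightarrow> complex"
    and \<kappa> :: "'a \<Rightarrow> complex ^ 5"
    and k :: "'a \<Rightarrow> real"
  assumes "riemann_surface X A"
    and "holomorphic_coordinate X A z"
    and "isothermic_surface X z \<Lambda> \<eta>"
    and "normalised_lift X z \<Lambda> \<psi>"
    and "eta_of_coordinate X z \<psi> \<eta>"
    and "schwarzian_hopf X z \<psi> c \<kappa>"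
    and "smooth_on X z (topspace X) N"
    and "\<And>p. p \<in> topspace X \<Longrightarrow> N p \<in> orth (central_sphere X z \<psi> p) \<and> lor (N p) (N p) = 1"
    and "smooth_on X z (topspace X) k"
    and "\<And>p. p \<in> topspace X \<Longrightarrow> \<kappa> p = complex_of_real (k p) *s cvec (N p)"
  shows "special_isothermic X z \<Lambda> \<eta> 2 \<longleftrightarrow>
    (\<exists>s\<^sub>1 s\<^sub>2 :: real. \<forall>p\<in>topspace X.
      (let D = d_z X z; D' = d_zbar X z; K = (\<lambda>q. complex_of_real (k q)) in
        4 * D (D (D (D K))) p
        + 4 * c p * D (D K) p
        + 4 * D c p * D K p
        + (2 * D (D c) p + (c p)\<^sup>2) * K p
        + 8 * (D' (D K) p * K p + (K p) ^ 4 - D K p * D' K p) * K p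
        + complex_of_real s\<^sub>1 * (2 * D (D K) p + c p * K p)
        + complex_of_real s\<^sub>2 * K p = 0))"
    (is "_ \<longleftrightarrow> ?rhs")
proof -
  interpret coordinate_surface X z
    by standard (use assms(1,2) in \<open>simp_all add: riemann_surface_def holomorphic_coordinate_def\<close>)
  have \<psi>: "sm \<psi>" "\<And>p. p \<in> S \<Longrightarrow> \<psi> p \<in> \<Lambda> p"
    "\<And>p \<xi>. p \<in> S \<Longrightarrow> lor (dd \<psi> p \<xi>) (dd \<psi> p \<xi>) = (cmod \<xi>)\<^sup>2"
    using assms(4) by (simp_all add: normalised_lift_def section_of_def)
  have \<Lambda>: "\<Lambda> p \<in> null_lines" if "p \<in> S" for p
    using assms(3) that by (simp add: isothermic_surface_def conformal_immersion_def)
  interpret isothermic_frame X z "\<lambda>q. cvec (\<psi> q)" "\<lambda>q. cvec (N q)" c "\<lambda>q. complex_of_real (k q)"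
  proof
    show "smooth_vec (\<lambda>q. cvec (\<psi> q))" "smooth_vec (\<lambda>q. cvec (N q))"
      using smooth_cvec \<psi>(1) assms(7) by blast+
    show "sm c" using assms(6) by (simp add: schwarzian_hopf_def)
    show "sm (\<lambda>q. complex_of_real (k q))"
      by (rule smooth_bounded_linear[OF bounded_linear_of_real assms(9)])
    fix p assume p: "p \<in> S"
    show "lor (cvec (\<psi> p)) (cvec (\<psi> p)) = 0"
      using null_line_member[OF \<Lambda>[OF p] \<psi>(2)[OF p]] by (simp add: lor_cvec)
    show "lor (vz (\<lambda>q. cvec (\<psi> q)) p) (vz (\<lambda>q. cvec (\<psi> q)) p) = 0"
      "lor (vz (\<lambda>q. cvec (\<psi> q)) p) (vzb (\<lambda>q. cvec (\<psi> q)) p) = 1 / 2"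
      using conformal_products[OF \<psi>(1) p \<psi>(3)[OF p]] .
    show "lor (cvec (N p)) (cvec (N p)) = 1"
      using assms(8)[OF p] by (simp add: lor_cvec)
    show "lor (cvec (N p)) (cvec (\<psi> p)) = 0"
      "lor (cvec (N p)) (vz (\<lambda>q. cvec (\<psi> q)) p) = 0"
      "lor (cvec (N p)) (vzb (vz (\<lambda>q. cvec (\<psi> q))) p) = 0"
      using orth_central_sphere[OF \<psi>(1) p] assms(8)[OF p] by blast+
    show "vz (vz (\<lambda>q. cvec (\<psi> q))) p + (c p / 2) *s cvec (\<psi> p) = complex_of_real (k p) *s cvec (N p)"
      using assms(6,10) p by (simp add: schwarzian_hopf_def)
  qed simp_all
  have eta: "cvec (\<eta> p \<xi> w) = - wedge (cvec (\<psi> p))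
      (\<xi> *s vzb (\<lambda>q. cvec (\<psi> q)) p + cnj \<xi> *s vz (\<lambda>q. cvec (\<psi> q)) p) (cvec w)" if "p \<in> S" for p \<xi> w
    using assms(5) that by (simp add: eta_of_coordinate_def Let_def)
  have "S \<noteq> {}" using assms(1) unfolding riemann_surface_def by blast
  have "special_isothermic X z \<Lambda> \<eta> 2 \<longleftrightarrow>
      (\<exists>s1 s2 :: real. \<forall>p\<in>S. 2 * dz (dz \<delta>) p + c p * \<delta> p + 4 * \<mu> p * complex_of_real (k p)
        + complex_of_real s1 * \<delta> p + complex_of_real s2 * complex_of_real (k p) = 0)"
    unfolding special_isothermic_def
    by (subst conserved_quadratic_iff_equation[symmetric])
       (use eta \<open>S \<noteq> {}\<close> assms(3) in simp_all)
  also have "\<dots> \<longleftrightarrow> ?rhs"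
    unfolding Let_def by (intro ex_cong1 ball_cong refl) (simp only: equation_normal_form)
  finally show ?thesis .
qed

end
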